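(* Let $F:\mathrm{LC}_{\rm c}(\mathbb{R}^n)\to(0,\infty)$. (1) Suppose that $F$ is nondecreasing under Steiner symmetrizations, i.e., $F(S_Hf)\geq F(f)$ for every $f\in\mathrm{LC}_{\rm c}(\mathbb{R}^n)$ and every hyperplane $H\in\mathrm{Gr}(n,n-1)$, and that $F$ is upper semicontinuous with respect to the $L^1(\mathbb{R}^n)$ metric. Then for every $f\in\mathrm{LC}_{\rm c}(\mathbb{R}^n)$ we have $F(f)\leq F(f^* )$. (2) Suppose that $F$ is nonincreasing under Steiner symmetrizations, i.e., $F(S_Hf)\leq F(f)$ for every $f\in\mathrm{LC}_{\rm c}(\mathbb{R}^n)$ and every hyperplane $H\in\mathrm{Gr}(n,n-1)$, and that $F$ is lower semicontinuous with respect to the $L^1(\mathbb{R}^n)$ metric. Then for every $f\in\mathrm{LC}_{\rm c}(\mathbb{R}^n)$ we have $F(f)\geq F(f^* )$. Here $S_Hf$ is the Steiner symmetral of $f$ with respect to $H$ and $f^*$ is the symmetric decreasing rearrangement of $f$.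
   Context: $n\geq 1$ is an integer and $\mathrm{Gr}(n,n-1)$ is the set of $(n-1)$-dimensional linear subspaces of $\mathbb{R}^n$. **Function classes.** For convex $\psi:\mathbb{R}^n\to\mathbb{R}\cup\{+\infty\}$, $\mathrm{dom}(\psi)=\{x:\psi(x)<+\infty\}$. $\mathrm{Conv}_{\rm c}(\mathbb{R}^n)$ is the set of convex functions $\psi:\mathbb{R}^n\to\mathbb{R}\cup\{+\infty\}$ which are coercive ($\lim_{\|x\|\to\infty}\psi(x)=\infty$), lower semicontinuous (closed epigraph), $\psi\not\equiv+\infty$, with $o\in\mathrm{dom}(\psi)$ (where $o$ is the origin) and $\mathrm{dom}(\psi)$ not contained in a hyperplane. $\mathrm{LC}_{\rm c}(\mathbb{R}^n):=\{e^{-\psi}:\psi\in\mathrm{Conv}_{\rm c}(\mathbb{R}^n)\}$, with $e^{-\infty}=0$. All such functions are integrable. **Steiner symmetrization.** Let $f\in\mathrm{LC}_{\rm c}(\mathbb{R}^n)$ and $H=u^\perp\in\mathrm{Gr}(n,n-1)$ with $u$ a unit vector. For $y\in H$ and $s>0$ such that $\{t\in\mathbb{R}:f(y+tu)\geq s\}\neq\varnothing$, let $f^+(y,s)$ and $f^-(y,s)$ be the supremum and infimum of this set (both finite). The Steiner symmetral $S_Hf:\mathbb{R}^n\to[0,\infty)$ is the function whose hypograph $\{(x,s): 0<s\leq S_Hf(x)\}$ equals the set of all $(y+tu,s)$ with $y\in H$, $s>0$, $\{\tau\in\mathbb{R}:f(y+\tau u)\geq s\}\neq\varnothing$ and $|t|\leq\frac12(f^+(y,s)-f^-(y,s))$.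 One has $S_Hf\in\mathrm{LC}_{\rm c}(\mathbb{R}^n)$. **Symmetric decreasing rearrangement.** For a measurable set $A\subset\mathbb{R}^n$ of finite volume, $B_A$ is the closed Euclidean ball centered at the origin with the same volume as $A$ (with $B_A=\{o\}$ if $A$ is nonempty of volume zero, and $B_\varnothing=\varnothing$). For $f\in\mathrm{LC}_{\rm c}(\mathbb{R}^n)$, $f^*:\mathbb{R}^n\to[0,\infty)$ is the function with $\{x: f^*(x)\geq t\}=B_{\{x:f(x)\geq t\}}$ for all $t>0$; one has $f^*\in\mathrm{LC}_{\rm c}(\mathbb{R}^n)$. **Semicontinuity.** $F$ is upper (respectively lower) semicontinuous with respect to the $L^1$ metric if $f_j,f\in\mathrm{LC}_{\rm c}(\mathbb{R}^n)$ and $\|f_j-f\|_{L^1}\to 0$ imply $\limsup_j F(f_j)\leq F(f)$ (respectively $\liminf_j F(f_j)\geq F(f)$). *)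

theory Defs
  imports "HOL-Analysis.Analysis"
begin

definition eff_dom :: "(real^'n \<Rightarrow> ereal) \<Rightarrow> (real^'n) set" where
  "eff_dom \<psi> = {x. \<psi> x < \<infinity>}"

(* The library's convex_on and epigraph only cover real-valued functions. *)
definition ereal_convex :: "(real^'n \<Rightarrow> ereal) \<Rightarrow> bool" where
  "ereal_convex \<psi> \<longleftrightarrow>
     (\<forall>x y t. 0 < t \<and> t < 1 \<longrightarrow>
        \<psi> ((1 - t) *\<^sub>R x + t *\<^sub>R y) \<le> ereal (1 - t) * \<psi> x + ereal t * \<psi> y)"

definition ereal_epigraph :: "(real^'n \<Rightarrow> ereal) \<Rightarrow> ((real^'n) \<times> real) set" where
  "ereal_epigraph \<psi> = {(x, r). \<psi> x \<le> ereal r}"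

definition Conv_c :: "(real^'n \<Rightarrow> ereal) set" where
  "Conv_c = {\<psi>. (\<forall>x. \<psi> x \<noteq> -\<infinity>)
              \<and> ereal_convex \<psi>
              \<and> (\<psi> \<longlongrightarrow> \<infinity>) at_infinity
              \<and> closed (ereal_epigraph \<psi>)
              \<and> (\<exists>x. \<psi> x \<noteq> \<infinity>)
              \<and> 0 \<in> eff_dom \<psi>
              \<and> \<not> (\<exists>a b. a \<noteq> 0 \<and> eff_dom \<psi> \<subseteq> {x. a \<bullet> x = b})}"

(* exp (- v) with the convention exp (-\<infinity>) = 0; only applied to v \<noteq> -\<infinity>. *)
definition exp_neg :: "ereal \<Rightarrow> real" where
  "exp_neg v = (if v = \<infinity> then 0 else exp (- real_of_ereal v))"

definition LC_c :: "(real^'n \<Rightarrow> real) set" where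
  "LC_c = {f. \<exists>\<psi>\<in>Conv_c. f = (\<lambda>x. exp_neg (\<psi> x))}"

definition Gr_hyp :: "(real^'n) set set" where
  "Gr_hyp = {H :: (real^'n) set. subspace H \<and> dim H = CARD('n) - 1}"

definition hypograph :: "(real^'n \<Rightarrow> real) \<Rightarrow> ((real^'n) \<times> real) set" where
  "hypograph g = {(x, s). 0 < s \<and> s \<le> g x}"

definition line_level :: "(real^'n \<Rightarrow> real) \<Rightarrow> real^'n \<Rightarrow> real^'n \<Rightarrow> real \<Rightarrow> real set" where
  "line_level f u y s = {t. s \<le> f (y + t *\<^sub>R u)}"

definition steiner_region :: "real^'n \<Rightarrow> (real^'n \<Rightarrow> real) \<Rightarrow> ((real^'n) \<times> real) set" where
  "steiner_region u f =
     {(y + t *\<^sub>R u, s) | y t s. y \<in> {u}\<^sup>\<bottom> \<and> 0 < s \<and> line_level f u y s \<noteq> {}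
        \<and> \<bar>t\<bar> \<le> (1/2) * (Sup (line_level f u y s) - Inf (line_level f u y s))}"

(* The two unit normals u, -u of H give the same region. For f in LC_c and H in Gr_hyp
   the function described by THE exists and is unique. *)
definition steiner :: "(real^'n) set \<Rightarrow> (real^'n \<Rightarrow> real) \<Rightarrow> (real^'n \<Rightarrow> real)" where
  "steiner H f = (THE g. (\<forall>x. 0 \<le> g x) \<and>
     (\<exists>u. norm u = 1 \<and> H = {u}\<^sup>\<bottom> \<and> hypograph g = steiner_region u f))"

(* For nonempty null sets the radius is 0, so the ball is {0}. *)
definition sym_ball :: "(real^'n) set \<Rightarrow> (real^'n) set" where
  "sym_ball A = (if A = {} then {}
     else cball 0 (THE r. 0 \<le> r \<and> emeasure lebesgue (cball (0 :: real^'n) r) = emeasure lebesgue A))"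

(* For f in LC_c the sets {x. t \<le> f x} with t > 0 are compact, and the function described
   by THE exists and is unique. *)
definition sym_decr :: "(real^'n \<Rightarrow> real) \<Rightarrow> (real^'n \<Rightarrow> real)" where
  "sym_decr f = (THE g. (\<forall>x. 0 \<le> g x) \<and>
     (\<forall>t>0. {x. t \<le> g x} = sym_ball {x. t \<le> f x}))"

(* The nonnegative integral is used so that no default value for non-integrable functions
   enters. *)
definition L1_tendsto :: "(nat \<Rightarrow> real^'n \<Rightarrow> real) \<Rightarrow> (real^'n \<Rightarrow> real) \<Rightarrow> bool" where
  "L1_tendsto fj f \<longleftrightarrow>
     (\<lambda>j. \<integral>\<^sup>+x. ennreal \<bar>fj j x - f x\<bar> \<partial>lebesgue) \<longlonglongrightarrow> 0"

definition L1_usc :: "((real^'n \<Rightarrow> real) \<Rightarrow> real) \<Rightarrow> bool" where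
  "L1_usc F \<longleftrightarrow> (\<forall>fj f. (\<forall>j. fj j \<in> LC_c) \<and> f \<in> LC_c \<and> L1_tendsto fj f \<longrightarrow>
      limsup (\<lambda>j. ereal (F (fj j))) \<le> ereal (F f))"

definition L1_lsc :: "((real^'n \<Rightarrow> real) \<Rightarrow> real) \<Rightarrow> bool" where
  "L1_lsc F \<longleftrightarrow> (\<forall>fj f. (\<forall>j. fj j \<in> LC_c) \<and> f \<in> LC_c \<and> L1_tendsto fj f \<longrightarrow>
      ereal (F f) \<le> liminf (\<lambda>j. ereal (F (fj j))))"

end

theory Submission
  imports Defs "HOL-Real_Asymp.Real_Asymp"
begin

text \<open>Both parts rest on one fact: for every log-concave \<open>f\<close> of the class,
finitely iterated Steiner symmetrals of \<open>f\<close> come arbitrarily close in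
\<open>L\<^sup>1\<close> to the symmetric decreasing rearrangement \<open>g\<close>. A functional
that is nondecreasing (nonincreasing) under symmetrization is at each of these symmetrals at least
(at most) its value at \<open>f\<close>, and semicontinuity transfers the inequality to
\<open>g\<close>; for this, \<open>g\<close> has to belong to the class as well.

The convergence comes from a quantitative gain in a well-chosen direction. Let \<open>A\<close> be a
level set of the current symmetral \<open>h\<close> and \<open>B\<close> the centred ball of the
same volume. On every line in direction \<open>u\<close> the chords of the symmetral of
\<open>A\<close> and of \<open>B\<close> are concentric, so their intersection is the shorter of the
two. Consequently symmetrization in direction \<open>u\<close> increases the volume shared with
\<open>B\<close> by at least the volume of the points of \<open>A - B\<close> that a given
translation \<open>v\<close> parallel to \<open>u\<close> carries into \<open>B - A\<close>
(\<open>steiner_set_overlap\<close>). Integrated over all \<open>v\<close> in space, these gains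
give the square of the volume of \<open>A - B\<close>, while only translations in a fixed ball
contribute. So some \<open>v\<close> gains at least a fixed multiple of this square. Integrating
over the levels shows that some direction increases the integral of \<open>min h g\<close> by a
positive amount depending only on \<open>f\<close> and on how far this integral still is from its
maximal value, the integral of \<open>f\<close> (\<open>steiner_orbit_uniform_gain\<close>). Since
this cannot be repeated indefinitely, the deficit becomes arbitrarily small, and the deficit is half
the \<open>L\<^sup>1\<close> distance (\<open>steiner_orbit_L1_approx\<close>).

That \<open>g\<close> is log-concave amounts to the Brunn--Minkowski inequality for level sets. It
comes out of the same convergence: the symmetrals are log-concave, and log-concavity survives almost
everywhere limits (\<open>symmetric_rearrangement_log_concave\<close>).

All of this takes place for functions described by their superlevel sets, in which both operations
are simple. The functions in \<^const>\<open>LC_c\<close> are exactly those of this description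
(\<open>LC_c_iff\<close>), and \<^const>\<open>steiner\<close> and \<^const>\<open>sym_decr\<close>,
which are given as uniquely determined functions, agree with the level set constructions on
it.\<close>

section \<open>Integration along parallel lines\<close>

lemma nn_integral_lborel_shift:
  fixes h :: "'a::euclidean_space \<Rightarrow> ennreal"
  assumes [measurable]: "h \<in> borel_measurable borel"
  shows "(\<integral>\<^sup>+x. h (x + c) \<partial>lborel) = (\<integral>\<^sup>+x. h x \<partial>lborel)"
proof -
  have "(\<integral>\<^sup>+x. h x \<partial>lborel) = (\<integral>\<^sup>+x. h x \<partial>distr lborel borel ((+) c))"
    by (simp add: lborel_distr_plus)
  also have "\<dots> = (\<integral>\<^sup>+x. h (c + x) \<partial>lborel)"
    by (subst nn_integral_distr) auto
  finally show ?thesis by (simp add: add.commute)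
qed

lemma emeasure_lborel_shift:
  fixes A :: "'a::euclidean_space set"
  assumes [measurable]: "A \<in> sets borel"
  shows "emeasure lborel {x. x + c \<in> A} = emeasure lborel A"
proof -
  have "emeasure lborel {x. x + c \<in> A} = (\<integral>\<^sup>+x. indicator {x. x + c \<in> A} x \<partial>lborel)"
    by (subst nn_integral_indicator) auto
  also have "\<dots> = (\<integral>\<^sup>+x. indicator A (x + c) \<partial>lborel)"
    by (rule nn_integral_cong) (auto simp: indicator_def)
  also have "\<dots> = (\<integral>\<^sup>+x. indicator A x \<partial>lborel)"
    by (rule nn_integral_lborel_shift) auto
  finally show ?thesis by simp
qed

text \<open>Fubini in an arbitrary direction \<open>u\<close>: every point is visited by the lines
starting in the slab \<open>0 \<le> x \<bullet> u \<le> 1\<close> for a parameter set of length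
exactly one, so averaging over the slab counts each point once.\<close>
lemma nn_integral_lborel_lines:
  fixes h :: "'a::euclidean_space \<Rightarrow> ennreal"
  assumes u: "norm u = 1" and [measurable]: "h \<in> borel_measurable borel"
  shows "(\<integral>\<^sup>+x. h x \<partial>lborel) =
    (\<integral>\<^sup>+x. indicator {x. 0 \<le> x \<bullet> u \<and> x \<bullet> u \<le> 1} x * (\<integral>\<^sup>+t. h (x + t *\<^sub>R u) \<partial>lborel) \<partial>lborel)"
proof -
  let ?I = "\<lambda>x. indicator {x. 0 \<le> x \<bullet> u \<and> x \<bullet> u \<le> 1} x :: ennreal"
  have [measurable]: "?I \<in> borel_measurable borel" by measurable
  have uu: "u \<bullet> u = 1" using u by (simp add: norm_eq_1)
  have "(\<integral>\<^sup>+x. ?I x * (\<integral>\<^sup>+t. h (x + t *\<^sub>R u) \<partial>lborel) \<partial>lborel)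
      = (\<integral>\<^sup>+x. (\<integral>\<^sup>+t. ?I x * h (x + t *\<^sub>R u) \<partial>lborel) \<partial>lborel)"
    by (intro nn_integral_cong nn_integral_cmult [symmetric]) measurable
  also have "\<dots> = (\<integral>\<^sup>+t. (\<integral>\<^sup>+x. ?I x * h (x + t *\<^sub>R u) \<partial>lborel) \<partial>lborel)"
    by (rule lborel_pair.Fubini'[symmetric]) measurable
  also have "\<dots> = (\<integral>\<^sup>+t. (\<integral>\<^sup>+x. ?I (x - t *\<^sub>R u) * h x \<partial>lborel) \<partial>lborel)"
  proof (rule nn_integral_cong)
    fix t
    show "(\<integral>\<^sup>+x. ?I x * h (x + t *\<^sub>R u) \<partial>lborel) = (\<integral>\<^sup>+x. ?I (x - t *\<^sub>R u) * h x \<partial>lborel)"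
      using nn_integral_lborel_shift [of "\<lambda>x. ?I (x - t *\<^sub>R u) * h x" "t *\<^sub>R u"] by simp
  qed
  also have "\<dots> = (\<integral>\<^sup>+x. (\<integral>\<^sup>+t. ?I (x - t *\<^sub>R u) * h x \<partial>lborel) \<partial>lborel)"
    by (rule lborel_pair.Fubini') measurable
  also have "\<dots> = (\<integral>\<^sup>+x. h x \<partial>lborel)"
  proof (rule nn_integral_cong)
    fix x
    have "(\<integral>\<^sup>+t. ?I (x - t *\<^sub>R u) * h x \<partial>lborel) = (\<integral>\<^sup>+t. indicator {x \<bullet> u - 1 .. x \<bullet> u} t * h x \<partial>lborel)"
      by (rule nn_integral_cong) (auto simp: indicator_def inner_diff_left uu)
    also have "\<dots> = h x"
      by (subst nn_integral_multc) auto
    finally show "(\<integral>\<^sup>+t. ?I (x - t *\<^sub>R u) * h x \<partial>lborel) = h x" .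
  qed
  finally show ?thesis by simp
qed

lemma emeasure_le_linewise:
  fixes A B :: "'a::euclidean_space set"
  assumes u: "norm u = 1" and [measurable]: "A \<in> sets borel" "B \<in> sets borel"
    and le: "\<And>x. emeasure lborel {t. x + t *\<^sub>R u \<in> A} \<le> emeasure lborel {t. x + t *\<^sub>R u \<in> B}"
  shows "emeasure lborel A \<le> emeasure lborel B"
proof -
  have line: "(\<integral>\<^sup>+t. indicator C (x + t *\<^sub>R u) \<partial>lborel) = emeasure lborel {t. x + t *\<^sub>R u \<in> C}"
    if [measurable]: "C \<in> sets borel" for x and C :: "'a set"
  proof -
    have "(\<integral>\<^sup>+t. indicator C (x + t *\<^sub>R u) \<partial>lborel) = (\<integral>\<^sup>+t. indicator {t. x + t *\<^sub>R u \<in> C} t \<partial>lborel)"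
      by (rule nn_integral_cong) (auto simp: indicator_def)
    also have "\<dots> = emeasure lborel {t. x + t *\<^sub>R u \<in> C}"
      by (rule nn_integral_indicator) measurable
    finally show ?thesis .
  qed
  have "emeasure lborel C = (\<integral>\<^sup>+x. indicator {x. 0 \<le> x \<bullet> u \<and> x \<bullet> u \<le> 1} x
      * emeasure lborel {t. x + t *\<^sub>R u \<in> C} \<partial>lborel)"
    if [measurable]: "C \<in> sets borel" for C
    using nn_integral_lborel_lines [OF u, of "indicator C"] by (simp add: line)
  then show ?thesis
    by (auto intro!: nn_integral_mono mult_left_mono le)
qed

section \<open>Steiner symmetrization of compact convex sets\<close>

definition reflect :: "'a::real_inner \<Rightarrow> 'a \<Rightarrow> 'a" where
  "reflect u x = x - (2 * (x \<bullet> u)) *\<^sub>R u"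

text \<open>For a compact convex set the chord in direction \<open>u\<close> is a segment, and a
point at signed distance \<open>t\<close> from the hyperplane lies in the symmetral exactly if the
chord has length at least \<open>2 * \<bar>t\<bar>\<close>, that is, if a common translation along
\<open>u\<close> carries the point and its mirror image into the set. Convex combinations and
compactness arguments apply directly to this existential form.\<close>
definition steiner_set :: "'a::real_inner \<Rightarrow> 'a set \<Rightarrow> 'a set" where
  "steiner_set u A = {x. \<exists>c. x + c *\<^sub>R u \<in> A \<and> reflect u x + c *\<^sub>R u \<in> A}"

lemma reflect_line:
  assumes "norm u = 1"
  shows "reflect u (x + t *\<^sub>R u) = x + (- 2 * (x \<bullet> u) - t) *\<^sub>R u"
proof -
  have "u \<bullet> u = 1" using assms by (simp add: norm_eq_1)
  then show ?thesis
    by (simp add: reflect_def algebra_simps) (metis mult_2_right scaleR_left_distrib)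
qed

lemma steiner_set_mono: "A \<subseteq> B \<Longrightarrow> steiner_set u A \<subseteq> steiner_set u B"
  unfolding steiner_set_def by blast

text \<open>The squared norms of the two translated points average to \<open>(norm x)\<^sup>2 +
c\<^sup>2\<close>, hence one of them is at least as far from the origin as \<open>x\<close>.\<close>
lemma steiner_set_subset_cball:
  assumes u: "norm u = 1" and "A \<subseteq> cball 0 R"
  shows "steiner_set u A \<subseteq> cball 0 R"
proof
  fix x assume "x \<in> steiner_set u A"
  then obtain c where c: "norm (x + c *\<^sub>R u) \<le> R" "norm (reflect u x + c *\<^sub>R u) \<le> R"
    using assms(2) by (auto simp: steiner_set_def subset_iff)
  have uu: "u \<bullet> u = 1" using u by (simp add: norm_eq_1)
  have "norm (x + c *\<^sub>R u) ^ 2 + norm (reflect u x + c *\<^sub>R u) ^ 2 = 2 * (norm x)\<^sup>2 + 2 * c\<^sup>2"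
    by (simp only: power2_norm_eq_inner reflect_def)
      (simp add: algebra_simps inner_commute uu power2_eq_square)
  moreover have "norm (x + c *\<^sub>R u) ^ 2 \<le> R ^ 2" "norm (reflect u x + c *\<^sub>R u) ^ 2 \<le> R ^ 2"
    using c by (auto intro: power_mono)
  ultimately have "(norm x)\<^sup>2 \<le> R\<^sup>2" by (smt (verit) zero_le_power2)
  moreover have "0 \<le> R" using c(1) norm_ge_zero order_trans by blast
  ultimately show "x \<in> cball 0 R" by (simp add: power2_le_iff_abs_le)
qed

text \<open>The symmetral is the continuous image of the compact set of pairs of points of
\<open>A\<close> with the same projection to the hyperplane: such a pair is sent to this projection
plus half its difference.\<close>
lemma compact_steiner_set:
  fixes A :: "'a::euclidean_space set"
  assumes u: "norm u = 1" and A: "compact A"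
  shows "compact (steiner_set u A)"
proof -
  have uu: "u \<bullet> u = 1" using u by (simp add: norm_eq_1)
  let ?T = "(A \<times> A) \<inter> {p. fst p - (fst p \<bullet> u) *\<^sub>R u = snd p - (snd p \<bullet> u) *\<^sub>R u}"
  let ?m = "\<lambda>p. fst p - (fst p \<bullet> u) *\<^sub>R u + (1/2) *\<^sub>R (fst p - snd p)"
  have "closed {p :: 'a \<times> 'a. fst p - (fst p \<bullet> u) *\<^sub>R u = snd p - (snd p \<bullet> u) *\<^sub>R u}"
    by (intro closed_Collect_eq continuous_intros)
  then have "compact ?T"
    using A by (intro compact_Int_closed compact_Times)
  then have "compact (?m ` ?T)"
    by (intro compact_continuous_image continuous_intros)
  moreover have "?m ` ?T = steiner_set u A"
  proof (intro set_eqI iffI)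
    fix x assume "x \<in> ?m ` ?T"
    then obtain a b where ab: "a \<in> A" "b \<in> A" "a - (a \<bullet> u) *\<^sub>R u = b - (b \<bullet> u) *\<^sub>R u"
      and x: "x = a - (a \<bullet> u) *\<^sub>R u + (1/2) *\<^sub>R (a - b)" by auto
    have b: "b = a + (b \<bullet> u - a \<bullet> u) *\<^sub>R u" using ab(3) by (simp add: algebra_simps)
    define k where "k = b \<bullet> u - a \<bullet> u"
    have bk: "b = a + k *\<^sub>R u" using b k_def by simp
    have xk: "x = a - (a \<bullet> u + k/2) *\<^sub>R u"
      unfolding x bk by (simp add: algebra_simps)
    have rx: "reflect u x = a - (a \<bullet> u - k/2) *\<^sub>R u"
      using reflect_line [OF u, of a "- (a \<bullet> u + k/2)"] by (simp add: xk algebra_simps)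
    have "x + (a \<bullet> u + k/2) *\<^sub>R u = a" by (simp add: xk)
    moreover have "reflect u x + (a \<bullet> u + k/2) *\<^sub>R u = b"
      unfolding rx bk by (simp add: scaleR_left_diff_distrib scaleR_left_distrib)
        (simp flip: scaleR_left_distrib)
    ultimately have "x + (a \<bullet> u + k/2) *\<^sub>R u \<in> A" "reflect u x + (a \<bullet> u + k/2) *\<^sub>R u \<in> A"
      using ab(1,2) by simp_all
    then show "x \<in> steiner_set u A" by (auto simp: steiner_set_def)
  next
    fix x assume "x \<in> steiner_set u A"
    then obtain c where c: "x + c *\<^sub>R u \<in> A" "reflect u x + c *\<^sub>R u \<in> A"
      by (auto simp: steiner_set_def)
    show "x \<in> ?m ` ?T"
      by (rule image_eqI [of _ _ "(x + c *\<^sub>R u, reflect u x + c *\<^sub>R u)"])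
        (use c in \<open>simp_all add: reflect_def algebra_simps uu flip: scaleR_2\<close>)
  qed
  ultimately show ?thesis by simp
qed

lemma steiner_set_line:
  fixes A :: "'a::euclidean_space set"
  assumes u: "norm u = 1"
    and ab: "{t. x + t *\<^sub>R u \<in> A} = {a..b}" "a \<le> b"
  shows "{t. x + t *\<^sub>R u \<in> steiner_set u A} = {t. \<bar>t + x \<bullet> u\<bar> \<le> (b - a) / 2}"
proof -
  have A: "x + t *\<^sub>R u \<in> A \<longleftrightarrow> a \<le> t \<and> t \<le> b" for t
    using ab(1) by (auto simp: set_eq_iff)
  have "x + t *\<^sub>R u \<in> steiner_set u A \<longleftrightarrow>
      (\<exists>c. x + (t + c) *\<^sub>R u \<in> A \<and> x + (- 2 * (x \<bullet> u) - t + c) *\<^sub>R u \<in> A)" for t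
    unfolding steiner_set_def mem_Collect_eq reflect_line [OF u]
    by (simp add: scaleR_add_left add.assoc)
  also have "\<dots> t \<longleftrightarrow> \<bar>t + x \<bullet> u\<bar> \<le> (b - a) / 2" for t
    unfolding A
  proof
    assume "\<bar>t + x \<bullet> u\<bar> \<le> (b - a) / 2"
    then show "\<exists>c. (a \<le> t + c \<and> t + c \<le> b) \<and> a \<le> - 2 * (x \<bullet> u) - t + c \<and> - 2 * (x \<bullet> u) - t + c \<le> b"
      by (intro exI [of _ "(a + b) / 2 + x \<bullet> u"]) argo
  next
    assume "\<exists>c. (a \<le> t + c \<and> t + c \<le> b) \<and> a \<le> - 2 * (x \<bullet> u) - t + c \<and> - 2 * (x \<bullet> u) - t + c \<le> b"
    then show "\<bar>t + x \<bullet> u\<bar> \<le> (b - a) / 2"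
      by (elim exE) argo
  qed
  finally show ?thesis by auto
qed

lemma steiner_set_line_cases:
  fixes A :: "'a::euclidean_space set"
  assumes u: "norm u = 1" and A: "compact A" "convex A"
  obtains a b where "a \<le> b" "{t. x + t *\<^sub>R u \<in> A} = {a..b}"
      "{t. x + t *\<^sub>R u \<in> steiner_set u A} = {t. \<bar>t + x \<bullet> u\<bar> \<le> (b - a) / 2}"
    | "{t. x + t *\<^sub>R u \<in> A} = {}" "{t. x + t *\<^sub>R u \<in> steiner_set u A} = {}"
proof (cases "{t. x + t *\<^sub>R u \<in> A} = {}")
  case True
  moreover have "{t. x + t *\<^sub>R u \<in> steiner_set u A} = {}"
  proof (rule ccontr)
    assume "{t. x + t *\<^sub>R u \<in> steiner_set u A} \<noteq> {}"
    then obtain t c where "x + t *\<^sub>R u + c *\<^sub>R u \<in> A" by (auto simp: steiner_set_def)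
    then have "t + c \<in> {t. x + t *\<^sub>R u \<in> A}" by (simp add: algebra_simps)
    with True show False by blast
  qed
  ultimately show ?thesis using that(2) by blast
next
  case False
  have inj: "inj (\<lambda>t. x + t *\<^sub>R u)"
    using u by (auto simp: inj_on_def)
  have "closed {t. x + t *\<^sub>R u \<in> A}"
    using continuous_closed_vimage [of A "\<lambda>t. x + t *\<^sub>R u"] A(1)
    by (simp add: vimage_def compact_imp_closed continuous_intros)
  moreover obtain R where R: "\<And>z. z \<in> A \<Longrightarrow> norm z \<le> R"
    using compact_imp_bounded [OF A(1)] by (auto simp: bounded_iff)
  have "\<bar>t\<bar> \<le> R + norm x" if "x + t *\<^sub>R u \<in> A" for t
    using R [OF that] norm_triangle_ineq4 [of "x + t *\<^sub>R u" x] u by simp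
  then have "bounded {t. x + t *\<^sub>R u \<in> A}"
    by (auto simp: bounded_iff)
  ultimately have "compact {t. x + t *\<^sub>R u \<in> A}"
    by (simp add: compact_eq_bounded_closed)
  moreover have "convex {t. x + t *\<^sub>R u \<in> A}"
  proof (rule convexI, clarify)
    fix p q \<alpha> \<beta> :: real
    assume h: "x + p *\<^sub>R u \<in> A" "x + q *\<^sub>R u \<in> A" "0 \<le> \<alpha>" "0 \<le> \<beta>" "\<alpha> + \<beta> = 1"
    have "\<alpha> *\<^sub>R (x + p *\<^sub>R u) + \<beta> *\<^sub>R (x + q *\<^sub>R u) = (\<alpha> + \<beta>) *\<^sub>R x + (\<alpha> *\<^sub>R p + \<beta> *\<^sub>R q) *\<^sub>R u"
      by (simp add: algebra_simps)
    then show "x + (\<alpha> *\<^sub>R p + \<beta> *\<^sub>R q) *\<^sub>R u \<in> A"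
      using convexD [OF A(2) h] h(5) by simp
  qed
  then have "connected {t. x + t *\<^sub>R u \<in> A}" by (rule convex_connected)
  ultimately obtain a b where ab: "{t. x + t *\<^sub>R u \<in> A} = {a..b}"
    using connected_compact_interval_1 by metis
  then have "a \<le> b" using False by auto
  with ab steiner_set_line [OF u ab] that(1) show ?thesis by blast
qed

lemma abs_le_eq_interval: "{t::real. \<bar>t + c\<bar> \<le> m} = {- c - m .. - c + m}"
  by (auto simp: abs_le_iff)

lemma emeasure_steiner_set_line:
  fixes A :: "'a::euclidean_space set"
  assumes u: "norm u = 1" and A: "compact A" "convex A"
  shows "emeasure lborel {t. x + t *\<^sub>R u \<in> steiner_set u A} = emeasure lborel {t. x + t *\<^sub>R u \<in> A}"
proof (rule steiner_set_line_cases [OF assms, of x])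
  fix a b assume "a \<le> b" "{t. x + t *\<^sub>R u \<in> A} = {a..b}"
    "{t. x + t *\<^sub>R u \<in> steiner_set u A} = {t. \<bar>t + x \<bullet> u\<bar> \<le> (b - a) / 2}"
  then show ?thesis by (simp only: abs_le_eq_interval) (simp add: emeasure_lborel_Icc_eq, argo)
qed simp

text \<open>Cavalieri's principle: symmetrization recentres each chord and keeps its length.\<close>
lemma emeasure_steiner_set:
  fixes A :: "'a::euclidean_space set"
  assumes u: "norm u = 1" and A: "compact A" "convex A"
  shows "emeasure lborel (steiner_set u A) = emeasure lborel A"
  using A compact_steiner_set [OF u A(1)]
  by (intro antisym emeasure_le_linewise [OF u])
    (simp_all add: emeasure_steiner_set_line [OF assms] borel_compact)

text \<open>The quantitative heart of the argument. On a line in direction \<open>u\<close> the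
chord of the symmetral and that of the centred ball \<open>B\<close> are concentric, so one contains
the other and their intersection has length \<open>min\<close> of the two chord lengths. The chord
of \<open>A\<close> contains both \<open>A \<inter> B\<close> and the points of \<open>A - B\<close>
that the translation carries into \<open>B - A\<close>; the chord of \<open>B\<close> is at least as
long as the same two pieces together, because the second one may be replaced by its translate. Thus
symmetrization gains at least the part of \<open>A - B\<close> that a translation along
\<open>u\<close> puts into the missing part \<open>B - A\<close>.\<close>
lemma steiner_set_overlap:
  fixes A :: "'a::euclidean_space set" and r \<tau> :: real
  assumes u: "norm u = 1" and A: "compact A" "convex A"
  defines "B \<equiv> cball 0 r"
  shows "emeasure lborel (A \<inter> B) + emeasure lborel {x. x \<in> A - B \<and> x + \<tau> *\<^sub>R u \<in> B - A}
      \<le> emeasure lborel (steiner_set u A \<inter> B)"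
proof -
  let ?S = "steiner_set u A"
  let ?W = "{x. x \<in> A - B \<and> x + \<tau> *\<^sub>R u \<in> B - A}"
  have uu: "u \<bullet> u = 1" using u by (simp add: norm_eq_1)
  have [measurable]: "A \<in> sets borel" "B \<in> sets borel" "?S \<in> sets borel"
    using A compact_steiner_set [OF u A(1)] by (auto simp: B_def borel_compact)
  have Wm [measurable]: "?W \<in> sets borel" by measurable
  have "emeasure lborel (A \<inter> B) + emeasure lborel ?W = emeasure lborel (A \<inter> B \<union> ?W)"
    by (rule plus_emeasure) auto
  also have "\<dots> \<le> emeasure lborel (?S \<inter> B)"
  proof (rule emeasure_le_linewise [OF u])
    fix x
    define I where "I = {t. x + t *\<^sub>R u \<in> A}"
    define J where "J = {t. x + t *\<^sub>R u \<in> ?S}"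
    define K where "K = {t. x + t *\<^sub>R u \<in> B}"
    have [measurable]: "I \<in> sets borel" "J \<in> sets borel" "K \<in> sets borel"
      unfolding I_def J_def K_def by measurable
    have IJ: "emeasure lborel J = emeasure lborel I"
      unfolding I_def J_def by (rule emeasure_steiner_set_line [OF u A])
    let ?L = "{t. x + t *\<^sub>R u \<in> A \<inter> B \<union> ?W}"
    have LI: "emeasure lborel ?L \<le> emeasure lborel I"
      by (rule emeasure_mono) (auto simp: I_def)
    have "emeasure lborel ?L \<le> emeasure lborel ((I \<inter> K) \<union> {t. t + \<tau> \<in> K - I})"
      by (rule emeasure_mono) (auto simp: I_def K_def algebra_simps)
    also have "\<dots> \<le> emeasure lborel (I \<inter> K) + emeasure lborel {t. t + \<tau> \<in> K - I}"
      by (rule emeasure_subadditive) measurable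
    \<comment> \<open>The second piece is replaced by its translate.\<close>
    also have "\<dots> = emeasure lborel (I \<inter> K) + emeasure lborel (K - I)"
      by (subst emeasure_lborel_shift) auto
    also have "\<dots> = emeasure lborel ((I \<inter> K) \<union> (K - I))"
      by (rule plus_emeasure) auto
    also have "(I \<inter> K) \<union> (K - I) = K" by auto
    finally have LK: "emeasure lborel ?L \<le> emeasure lborel K" .
    have K: "K = {t. 0 \<le> r \<and> (t + x \<bullet> u)\<^sup>2 \<le> r\<^sup>2 - (norm x)\<^sup>2 + (x \<bullet> u)\<^sup>2}"
    proof -
      have "norm (x + t *\<^sub>R u) \<le> r \<longleftrightarrow> 0 \<le> r \<and> (norm (x + t *\<^sub>R u))\<^sup>2 \<le> r\<^sup>2" for t
        by (metis norm_ge_zero order_trans power2_le_imp_le power_mono)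
      moreover have "(norm (x + t *\<^sub>R u))\<^sup>2 = (norm x)\<^sup>2 - (x \<bullet> u)\<^sup>2 + (t + x \<bullet> u)\<^sup>2" for t
        by (simp only: power2_norm_eq_inner)
          (simp add: algebra_simps inner_commute uu power2_eq_square)
      ultimately show ?thesis by (auto simp: K_def B_def)
    qed
    \<comment> \<open>Both chords are centred at the parameter where the line meets the hyperplane.\<close>
    have "J \<subseteq> K \<or> K \<subseteq> J"
    proof (rule steiner_set_line_cases [OF u A, of x])
      fix a b assume "{t. x + t *\<^sub>R u \<in> ?S} = {t. \<bar>t + x \<bullet> u\<bar> \<le> (b - a) / 2}" "a \<le> b"
      then have J: "J = {t. (t + x \<bullet> u)\<^sup>2 \<le> ((b - a)/2)\<^sup>2}"
        by (auto simp: J_def simp flip: abs_le_square_iff)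
      show ?thesis unfolding J K
        by auto
    qed (simp add: J_def)
    then have "J \<inter> K = J \<or> J \<inter> K = K" by blast
    then have "emeasure lborel ?L \<le> emeasure lborel (J \<inter> K)"
      using LI LK IJ by auto
    also have "J \<inter> K = {t. x + t *\<^sub>R u \<in> ?S \<inter> B}" by (auto simp: J_def K_def)
    finally show "emeasure lborel ?L \<le> emeasure lborel {t. x + t *\<^sub>R u \<in> ?S \<inter> B}" .
  qed auto
  finally show ?thesis .
qed

section \<open>Functions given by their superlevel sets\<close>

text \<open>The function with superlevel sets \<open>K s\<close>, for \<open>s > 0\<close>. The
inserted \<open>0\<close> makes it vanish at points in no level set, where the supremum would
otherwise be that of the empty set.\<close>
definition from_levels :: "(real \<Rightarrow> 'a set) \<Rightarrow> 'a \<Rightarrow> real" where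
  "from_levels K x = Sup (insert 0 {s. 0 < s \<and> x \<in> K s})"

text \<open>Left continuity of the family is what makes the supremum belong to the set of admissible
levels.\<close>
lemma from_levels:
  assumes mono: "\<And>s t. 0 < s \<Longrightarrow> s \<le> t \<Longrightarrow> K t \<subseteq> K s"
    and cont: "\<And>s x. 0 < s \<Longrightarrow> (\<And>s'. 0 < s' \<Longrightarrow> s' < s \<Longrightarrow> x \<in> K s') \<Longrightarrow> x \<in> K s"
    and M: "0 < M" "K M = {}"
  shows "0 \<le> from_levels K x" and "0 < s \<Longrightarrow> {x. s \<le> from_levels K x} = K s"
proof -
  have le: "r \<le> M" if "r \<in> insert 0 {s. 0 < s \<and> x \<in> K s}" for r x
  proof (rule ccontr)
    assume "\<not> r \<le> M"
    with that M(1) have "x \<in> K r" "M \<le> r" by auto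
    with mono [OF M(1)] M(2) show False by blast
  qed
  then have bdd: "bdd_above (insert 0 {s. 0 < s \<and> x \<in> K s})" for x
    by (rule bdd_aboveI)
  show "0 \<le> from_levels K x"
    unfolding from_levels_def by (rule cSup_upper [OF _ bdd]) simp
  show "{x. s \<le> from_levels K x} = K s" if s: "0 < s"
  proof (intro set_eqI iffI CollectI)
    fix x assume "x \<in> K s"
    then show "s \<le> from_levels K x"
      unfolding from_levels_def using s by (intro cSup_upper [OF _ bdd]) simp
  next
    fix x assume "x \<in> {x. s \<le> from_levels K x}"
    then have sx: "s \<le> from_levels K x" by simp
    show "x \<in> K s"
    proof (rule cont [OF s])
      fix s' assume s': "0 < s'" "s' < s"
      then obtain r where "r \<in> insert 0 {s. 0 < s \<and> x \<in> K s}" "s' < r"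
        using sx less_cSup_iff [OF _ bdd [of x], of s'] unfolding from_levels_def by force
      with s' have "x \<in> K r" "s' < r" by auto
      with mono [OF s'(1), of r] show "x \<in> K s'" by auto
    qed
  qed
qed

lemma nonneg_eqI_levels:
  fixes g h :: "'a \<Rightarrow> real"
  assumes "\<And>x. 0 \<le> g x" "\<And>x. 0 \<le> h x" "\<And>s. 0 < s \<Longrightarrow> {x. s \<le> g x} = {x. s \<le> h x}"
  shows "g = h"
proof
  fix x
  have *: "0 < s \<Longrightarrow> s \<le> g x \<longleftrightarrow> s \<le> h x" for s using assms(3) by blast
  show "g x = h x"
    using * [of "g x"] * [of "h x"] assms(1,2)[of x] by fastforce
qed

section \<open>Log-concave functions with compact superlevel sets\<close>

text \<open>This is \<^const>\<open>LC_c\<close> expressed through the function itself: compact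
superlevel sets encode coercivity and lower semicontinuity of \<open>- ln f\<close>, and a
superlevel set of positive volume encodes that the effective domain lies in no hyperplane. Steiner
symmetrization and the symmetric rearrangement act on superlevel sets, so they preserve conditions
of this form easily. Since \<open>0 powr t = 0\<close>, log-concavity is demanded only where both
values are positive.\<close>
definition closed_log_concave :: "('a::euclidean_space \<Rightarrow> real) \<Rightarrow> bool" where
  "closed_log_concave f \<longleftrightarrow> (\<forall>x. 0 \<le> f x)
     \<and> (\<forall>x y t. 0 < t \<and> t < 1 \<and> 0 < f x \<and> 0 < f y \<longrightarrow>
          f x powr (1 - t) * f y powr t \<le> f ((1 - t) *\<^sub>R x + t *\<^sub>R y))
     \<and> (\<forall>s>0. compact {x. s \<le> f x})
     \<and> 0 < f 0 \<and> (\<exists>s>0. 0 < emeasure lborel {x. s \<le> f x})"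

lemma powr_convex_comb_mono:
  fixes s r a b t :: real
  assumes "0 < s" "s \<le> a" "0 < r" "r \<le> b" "0 < t" "t < 1"
  shows "s powr (1 - t) * r powr t \<le> a powr (1 - t) * b powr t"
  using assms by (intro mult_mono powr_mono2) auto

lemma closed_log_concave_levels:
  assumes "closed_log_concave f" "0 < t" "t < 1" "0 < s" "0 < r" "s \<le> f x" "r \<le> f y"
  shows "s powr (1 - t) * r powr t \<le> f ((1 - t) *\<^sub>R x + t *\<^sub>R y)"
proof -
  have "s powr (1 - t) * r powr t \<le> f x powr (1 - t) * f y powr t"
    using assms by (intro powr_convex_comb_mono) auto
  also have "\<dots> \<le> f ((1 - t) *\<^sub>R x + t *\<^sub>R y)"
    using assms unfolding closed_log_concave_def by force
  finally show ?thesis .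
qed

lemma convex_level:
  assumes "closed_log_concave f" "0 < s"
  shows "convex {x. s \<le> f x}"
  unfolding convex_alt
proof (intro ballI allI impI, elim conjE, unfold mem_Collect_eq)
  fix x y and t :: real assume *: "s \<le> f x" "s \<le> f y" "0 \<le> t" "t \<le> 1"
  show "s \<le> f ((1 - t) *\<^sub>R x + t *\<^sub>R y)"
  proof (cases "t = 0 \<or> t = 1")
    case False
    have "s powr (1 - t) * s powr t = s" using assms(2) by (simp flip: powr_add)
    then show ?thesis
      using closed_log_concave_levels [OF assms(1), of t s s x y] * False assms(2) by simp
  qed (use * in auto)
qed

lemma borel_measurable_compact_levels:
  fixes f :: "'a::euclidean_space \<Rightarrow> real"
  assumes "\<And>x. 0 \<le> f x" "\<And>s. 0 < s \<Longrightarrow> compact {x. s \<le> f x}"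
  shows "f \<in> borel_measurable borel"
  unfolding borel_measurable_iff_ge
proof
  fix a show "{x \<in> space borel. a \<le> f x} \<in> sets borel"
  proof (cases "0 < a")
    case False
    then have "{x. a \<le> f x} = UNIV" using assms(1) by (auto intro: order_trans [of a 0])
    then show ?thesis by simp
  qed (use assms(2) in \<open>simp add: borel_compact\<close>)
qed

lemma borel_measurable_closed_log_concave:
  "closed_log_concave f \<Longrightarrow> f \<in> borel_measurable borel"
  by (rule borel_measurable_compact_levels) (auto simp: closed_log_concave_def)

text \<open>Nested nonempty compact sets have a common point; the property \<open>P\<close> allows
the search to be restricted to a closed set, such as a line.\<close>
lemma level_nonempty_from_below:
  fixes f :: "'a::euclidean_space \<Rightarrow> real"
  assumes f: "\<And>s. 0 < s \<Longrightarrow> compact {x. s \<le> f x}" and s: "0 < s"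
    and below: "\<And>s'. 0 < s' \<Longrightarrow> s' < s \<Longrightarrow> \<exists>x. s' \<le> f x \<and> P x" and P: "closed {x. P x}"
  shows "\<exists>x. s \<le> f x \<and> P x"
proof -
  define r where "r n = s - s / (real n + 2)" for n :: nat
  have r: "0 < r n" "r n < s" for n using s by (auto simp: r_def field_simps add_pos_nonneg)
  have "\<Inter>(range (\<lambda>n. {x. r n \<le> f x} \<inter> {x. P x})) \<noteq> {}"
  proof (rule compact_nest)
    fix n m :: nat assume "n \<le> m"
    then have "r n \<le> r m" using s by (simp add: r_def frac_le)
    then show "{x. r m \<le> f x} \<inter> {x. P x} \<subseteq> {x. r n \<le> f x} \<inter> {x. P x}" by auto
  next
    fix n
    show "compact ({x. r n \<le> f x} \<inter> {x. P x})" by (rule compact_Int_closed [OF f [OF r(1)] P])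
    show "{x. r n \<le> f x} \<inter> {x. P x} \<noteq> {}" using below [OF r] by blast
  qed
  then obtain x where x: "\<And>n. r n \<le> f x" "P x" by auto
  have "r \<longlonglongrightarrow> s - 0" unfolding r_def by (intro tendsto_intros) real_asymp
  then have "s \<le> f x" using x(1) by (intro LIMSEQ_le_const2 [of r s "f x"]) auto
  with x(2) show ?thesis by blast
qed

lemma bounded_above_compact_levels:
  fixes f :: "'a::euclidean_space \<Rightarrow> real"
  assumes f: "\<And>s. 0 < s \<Longrightarrow> compact {x. s \<le> f x}"
  obtains M where "0 < M" "\<And>x. f x < M"
proof -
  have "\<exists>n. {x. real (Suc n) \<le> f x} = {}"
  proof (rule ccontr)
    assume "\<nexists>n. {x. real (Suc n) \<le> f x} = {}"
    then have "\<Inter>(range (\<lambda>n. {x. real (Suc n) \<le> f x})) \<noteq> {}"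
      using f by (intro compact_nest) auto
    then obtain x where "\<And>n. real (Suc n) \<le> f x" by auto
    then show False using reals_Archimedean2 [of "f x"] by (meson Suc_n_not_le_n linorder_not_less nat_less_real_le of_nat_le_iff order_trans less_le)
  qed
  then obtain n where "{x. real (Suc n) \<le> f x} = {}" by blast
  then show ?thesis by (intro that [of "real (Suc n)"]) (auto simp: not_le)
qed

text \<open>The function is compared with its values on the shells \<open>k \<le> norm x \<le> k +
1\<close>; the volumes of the shells grow polynomially, while the values decay
exponentially.\<close>
lemma nn_integral_exp_norm_finite:
  fixes a :: real
  assumes a: "0 < a"
  shows "(\<integral>\<^sup>+x. ennreal (exp (- a * norm (x::'a::euclidean_space))) \<partial>lborel) < \<infinity>"
proof -
  let ?n = "DIM('a)"
  let ?b = "unit_ball_vol (real ?n)"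
  define c where "c k = exp (- a * real k) * (?b * (real k + 1) ^ ?n)" for k
  have b0: "0 \<le> ?b" by (simp add: unit_ball_vol_nonneg)
  have "summable c"
  proof (rule summable_comparison_test_ev)
    have "((\<lambda>k. (a * (real k + 1)) ^ (?n + 2) / exp (a * (real k + 1))) \<longlongrightarrow> 0) sequentially"
      by (rule filterlim_compose [OF tendsto_power_div_exp_0]) (use a in real_asymp)
    then have "eventually (\<lambda>k. (a * (real k + 1)) ^ (?n + 2) / exp (a * (real k + 1)) < 1) sequentially"
      by (rule order_tendstoD) simp
    then show "eventually (\<lambda>k. norm (c k) \<le> (?b * exp a / a ^ (?n + 2)) * (1 / (real (Suc k))\<^sup>2)) sequentially"
    proof eventually_elim
      case (elim k)
      have "(a * (real k + 1)) ^ (?n + 2) \<le> exp (a * (real k + 1))"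
        using elim by (simp add: divide_less_eq)
      then have "a ^ (?n + 2) * ((real k + 1) ^ ?n * (real k + 1)\<^sup>2) \<le> exp a * exp (a * real k)"
        by (simp only: power_mult_distrib power_add [symmetric] exp_add [symmetric]) (simp add: algebra_simps)
      then have "(real k + 1) ^ ?n * exp (- a * real k) \<le> exp a / a ^ (?n + 2) * (1 / (real k + 1)\<^sup>2)"
        using a by (simp add: divide_simps exp_minus mult_ac)
      from mult_left_mono [OF this b0] show ?case
        using b0 by (simp add: c_def mult_ac add.commute)
    qed
    show "summable (\<lambda>k. (?b * exp a / a ^ (?n + 2)) * (1 / (real (Suc k))\<^sup>2))"
      by (intro summable_mult, subst summable_Suc_iff) (simp add: inverse_power_summable flip: inverse_eq_divide)
  qed
  have c0: "0 \<le> c k" for k using b0 by (simp add: c_def)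
  have "(\<integral>\<^sup>+x. ennreal (exp (- a * norm (x::'a))) \<partial>lborel)
      \<le> (\<integral>\<^sup>+x. (\<Sum>k. ennreal (exp (- a * real k)) * indicator (cball 0 (real k + 1)) (x::'a)) \<partial>lborel)"
  proof (rule nn_integral_mono)
    fix x :: 'a
    define k where "k = nat \<lfloor>norm x\<rfloor>"
    have k: "real k \<le> norm x" "norm x \<le> real k + 1"
      unfolding k_def by (auto simp: of_nat_nat) 
    define G :: "nat \<Rightarrow> ennreal" where "G = (\<lambda>i. ennreal (exp (- a * real i)) * indicator (cball 0 (real i + 1)) x)"
    have "ennreal (exp (- a * norm x)) \<le> G k"
      using k a by (auto simp: G_def indicator_def intro!: ennreal_leI)
    also have "\<dots> = sum G {k}" by simp
    also have "\<dots> \<le> suminf G" by (rule sum_le_suminf) auto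
    finally show "ennreal (exp (- a * norm x)) \<le> (\<Sum>k. ennreal (exp (- a * real k)) * indicator (cball 0 (real k + 1)) x)"
      by (simp only: G_def)
  qed
  also have "\<dots> = (\<Sum>k. \<integral>\<^sup>+x. ennreal (exp (- a * real k)) * indicator (cball 0 (real k + 1)) (x::'a) \<partial>lborel)"
    by (rule nn_integral_suminf) (intro borel_measurable_times_ennreal borel_measurable_indicator, simp_all)
  also have "\<dots> = (\<Sum>k. ennreal (c k))"
    by (subst nn_integral_cmult_indicator) (auto simp: emeasure_cball c_def ennreal_mult b0)
  also have "\<dots> = ennreal (suminf c)"
    by (rule suminf_ennreal2) (use c0 \<open>summable c\<close> in auto)
  finally show ?thesis by (auto simp: less_top[symmetric] top_unique)
qed

text \<open>Far from the origin, the segment from \<open>0\<close> to \<open>x\<close> crosses a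
sphere on which \<open>f\<close> has already dropped below \<open>f 0 / e\<close>; log-concavity
extrapolates this drop linearly in \<open>ln f\<close>.\<close>
lemma closed_log_concave_exp_decay:
  fixes f :: "'a::euclidean_space \<Rightarrow> real"
  assumes f: "closed_log_concave f"
  obtains C a where "0 < a" "0 < C" "\<And>x. f x \<le> C * exp (- a * norm x)"
proof -
  have cpt: "\<And>s. 0 < s \<Longrightarrow> compact {x. s \<le> f x}" and f0: "0 < f 0" and pos: "\<And>x. 0 \<le> f x"
    using f by (auto simp: closed_log_concave_def)
  obtain M where M: "0 < M" "\<And>x. f x < M" using bounded_above_compact_levels [of f] cpt by blast
  obtain R0 where R0: "\<And>x. f 0 / exp 1 \<le> f x \<Longrightarrow> norm x \<le> R0"
    using compact_imp_bounded [OF cpt [of "f 0 / exp 1"]] f0 by (auto simp: bounded_iff)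
  \<comment> \<open>Strictly beyond the level set, so that the value on the sphere of radius \<open>R\<close> is below the level.\<close>
  define R where "R = \<bar>R0\<bar> + 1"
  have R: "0 < R" "R0 < R" by (auto simp: R_def)
  have far: "f x \<le> f 0 * exp (- (norm x / R))" if x: "R \<le> norm x" for x
  proof (cases "f x = 0")
    case False
    then have fx: "0 < f x" using pos [of x] by simp
    define t where "t = R / norm x"
    have t: "0 < t" "t \<le> 1" using R x by (auto simp: t_def divide_simps)
    have "x \<noteq> 0" using R x by auto
    then have "norm (t *\<^sub>R x) = R" using R by (simp add: t_def)
    then have z: "f (t *\<^sub>R x) < f 0 / exp 1" using R0 [of "t *\<^sub>R x"] R by force
    have "f 0 powr (1 - t) * f x powr t \<le> f (t *\<^sub>R x)"
    proof (cases "t = 1")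
      case False
      then show ?thesis using closed_log_concave_levels [OF f, of t "f 0" "f x" 0 x] t f0 fx by simp
    qed (use f0 fx in simp)
    with z have "f 0 powr (1 - t) * f x powr t < f 0 / exp 1" by simp
    then have "ln (f 0 powr (1 - t) * f x powr t) < ln (f 0 / exp 1)"
      using f0 fx by (subst ln_less_cancel_iff) auto
    then have "(1 - t) * ln (f 0) + t * ln (f x) < ln (f 0) - 1"
      using f0 fx by (simp add: ln_mult ln_powr ln_div)
    then have "t * (ln (f x) - ln (f 0)) < - 1" by (simp add: algebra_simps)
    then have "ln (f x) - ln (f 0) < - 1 / t" using t by (simp add: field_simps)
    then have "ln (f x) < ln (f 0) - norm x / R" by (simp add: t_def)
    then have "ln (f x) < ln (f 0 * exp (- (norm x / R)))" using f0 by (simp add: ln_mult)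
    then show ?thesis using f0 fx by (subst (asm) ln_less_cancel_iff) auto
  qed (use f0 in simp)
  have "f x \<le> (M * exp 1) * exp (- (1 / R) * norm x)" for x
  proof (cases "R \<le> norm x")
    case True
    have "f 0 * exp (- (norm x / R)) \<le> (M * exp 1) * exp (- (norm x / R))"
      using M(1) M(2) [of 0] f0 by (intro mult_right_mono) (auto intro: order_trans [OF less_imp_le])
    moreover have "- (1 / R) * norm x = - (norm x / R)" by simp
    ultimately show ?thesis using far [OF True] by (metis order_trans)
  next
    case False
    then have "norm x / R \<le> 1" using R by simp
    then have "1 \<le> exp 1 * exp (- (norm x / R))" by (simp flip: exp_add)
    then have "M * 1 \<le> M * (exp 1 * exp (- (norm x / R)))" using M(1) by (intro mult_left_mono) auto
    then show ?thesis using M(2) [of x] by simp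
  qed
  then show ?thesis using that [of "1 / R" "M * exp 1"] R M by simp
qed

lemma closed_log_concave_integral_finite:
  fixes f :: "'a::euclidean_space \<Rightarrow> real"
  assumes f: "closed_log_concave f"
  shows "(\<integral>\<^sup>+x. ennreal (f x) \<partial>lborel) < \<infinity>"
proof -
  obtain C a where Ca: "0 < a" "0 < C" "\<And>x. f x \<le> C * exp (- a * norm x)"
    using closed_log_concave_exp_decay [OF f] by blast
  have "(\<integral>\<^sup>+x. ennreal (f x) \<partial>lborel) \<le> (\<integral>\<^sup>+x. ennreal C * ennreal (exp (- a * norm (x::'a))) \<partial>lborel)"
    using Ca by (intro nn_integral_mono) (subst ennreal_mult [symmetric], auto intro!: ennreal_leI)
  also have "\<dots> = ennreal C * (\<integral>\<^sup>+x. ennreal (exp (- a * norm (x::'a))) \<partial>lborel)"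
    by (rule nn_integral_cmult) measurable
  also have "\<dots> < \<infinity>"
    using nn_integral_exp_norm_finite [OF Ca(1), where 'a = 'a] by (simp add: ennreal_mult_less_top)
  finally show ?thesis .
qed

section \<open>Steiner symmetrization of functions\<close>

definition steiner_fun :: "'a::euclidean_space \<Rightarrow> ('a \<Rightarrow> real) \<Rightarrow> 'a \<Rightarrow> real" where
  "steiner_fun u f = from_levels (\<lambda>s. steiner_set u {z. s \<le> f z})"

text \<open>The family of symmetrized level sets is left continuous because the translations
\<open>c\<close> witnessing membership of \<open>x\<close> at lower levels range over nested compact
sets.\<close>
lemma steiner_fun_levels:
  fixes f :: "'a::euclidean_space \<Rightarrow> real"
  assumes u: "norm u = 1" and f: "\<And>s. 0 < s \<Longrightarrow> compact {x. s \<le> f x}"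
  shows "0 \<le> steiner_fun u f x"
    and "0 < s \<Longrightarrow> {x. s \<le> steiner_fun u f x} = steiner_set u {x. s \<le> f x}"
proof -
  obtain M where M: "0 < M" "\<And>x. f x < M" using bounded_above_compact_levels [of f] f by blast
  then have empty: "{z. M \<le> f z} = {}" by (auto simp: not_le)
  have mono: "steiner_set u {z. t \<le> f z} \<subseteq> steiner_set u {z. s \<le> f z}" if "s \<le> t" for s t
    using that by (intro steiner_set_mono) auto
  have cont: "x \<in> steiner_set u {z. s \<le> f z}"
    if s: "0 < s" and x: "\<And>s'. 0 < s' \<Longrightarrow> s' < s \<Longrightarrow> x \<in> steiner_set u {z. s' \<le> f z}" for s x
  proof -
    \<comment> \<open>The levels of \<open>h\<close> on the line through \<open>x\<close> record the translations that witness membership.\<close>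
    define h where "h z = min (f z) (f (z + (reflect u x - x)))" for z
    have "compact {z. r \<le> h z}" if r: "0 < r" for r
    proof -
      have "{z. r \<le> h z} = {z. r \<le> f z} \<inter> (\<lambda>z. z - (reflect u x - x)) ` {z. r \<le> f z}"
        by (auto simp: h_def image_iff algebra_simps intro!: exI [of _ "_ + (reflect u x - x)"])
      moreover have "compact ((\<lambda>z. z - (reflect u x - x)) ` {z. r \<le> f z})"
        by (intro compact_continuous_image continuous_intros f r)
      ultimately show ?thesis using f [OF r] by (auto intro: compact_Int)
    qed
    moreover have "\<exists>z. s' \<le> h z \<and> z \<in> range (\<lambda>c. x + c *\<^sub>R u)" if s': "0 < s'" "s' < s" for s'
    proof -
      obtain c where "s' \<le> f (x + c *\<^sub>R u)" "s' \<le> f (reflect u x + c *\<^sub>R u)"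
        using x [OF s'] by (auto simp: steiner_set_def)
      then show ?thesis
        by (intro exI [of _ "x + c *\<^sub>R u"] conjI rangeI) (simp add: h_def algebra_simps)
    qed
    moreover have "closed {z. z \<in> range (\<lambda>c. x + c *\<^sub>R u)}"
    proof -
      have "closed (span {u})" by simp
      then have "closed ((+) x ` span {u})" by (rule closed_translation)
      moreover have "(+) x ` span {u} = range (\<lambda>c. x + c *\<^sub>R u)" by (auto simp: span_singleton)
      ultimately show ?thesis by simp
    qed
    ultimately have "\<exists>z. s \<le> h z \<and> z \<in> range (\<lambda>c. x + c *\<^sub>R u)"
      using s by - (rule level_nonempty_from_below)
    then show ?thesis by (auto simp: steiner_set_def h_def algebra_simps)
  qed
  have K: "steiner_set u {z. M \<le> f z} = {}" by (simp add: empty steiner_set_def)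
  show "0 \<le> steiner_fun u f x"
    unfolding steiner_fun_def by (rule from_levels(1) [where M = M]) (use mono cont M(1) K in auto)
  show "0 < s \<Longrightarrow> {x. s \<le> steiner_fun u f x} = steiner_set u {x. s \<le> f x}"
    unfolding steiner_fun_def by (rule from_levels(2) [where M = M]) (use mono cont M(1) K in auto)
qed

text \<open>Log-concavity is immediate from the description of \<^const>\<open>steiner_set\<close>:
if \<open>c\<close> and \<open>d\<close> witness the levels at \<open>x\<close> and
\<open>y\<close>, then \<open>(1 - t) * c + t * d\<close> witnesses the level at the convex
combination.\<close>
lemma closed_log_concave_steiner_fun:
  fixes f :: "'a::euclidean_space \<Rightarrow> real"
  assumes u: "norm u = 1" and f: "closed_log_concave f"
  shows "closed_log_concave (steiner_fun u f)"
proof -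
  let ?g = "steiner_fun u f"
  have cpt: "\<And>s. 0 < s \<Longrightarrow> compact {x. s \<le> f x}" and f0: "0 < f 0" and pos: "\<And>x. 0 \<le> f x"
    using f by (auto simp: closed_log_concave_def)
  have lev: "{x. s \<le> ?g x} = steiner_set u {x. s \<le> f x}" if "0 < s" for s
    using steiner_fun_levels(2) [OF u cpt that] by simp
  have lev': "s \<le> ?g x \<longleftrightarrow> (\<exists>c. s \<le> f (x + c *\<^sub>R u) \<and> s \<le> f (reflect u x + c *\<^sub>R u))" if "0 < s" for s x
    using lev [OF that] by (auto simp: steiner_set_def)
  have "?g x powr (1 - t) * ?g y powr t \<le> ?g ((1 - t) *\<^sub>R x + t *\<^sub>R y)"
    if t: "0 < t \<and> t < 1 \<and> 0 < ?g x \<and> 0 < ?g y" for x y t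
  proof -
    let ?z = "(1 - t) *\<^sub>R x + t *\<^sub>R y"
    obtain c where c: "?g x \<le> f (x + c *\<^sub>R u)" "?g x \<le> f (reflect u x + c *\<^sub>R u)"
      using t lev' [of "?g x" x] by auto
    obtain d where d: "?g y \<le> f (y + d *\<^sub>R u)" "?g y \<le> f (reflect u y + d *\<^sub>R u)"
      using t lev' [of "?g y" y] by auto
    have "(1 - t) *\<^sub>R (x + c *\<^sub>R u) + t *\<^sub>R (y + d *\<^sub>R u) = ?z + ((1 - t) * c + t * d) *\<^sub>R u"
      "(1 - t) *\<^sub>R (reflect u x + c *\<^sub>R u) + t *\<^sub>R (reflect u y + d *\<^sub>R u) = reflect u ?z + ((1 - t) * c + t * d) *\<^sub>R u"
      by (simp_all add: reflect_def algebra_simps)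
    then have "?g x powr (1 - t) * ?g y powr t \<le> f (?z + ((1 - t) * c + t * d) *\<^sub>R u)"
      "?g x powr (1 - t) * ?g y powr t \<le> f (reflect u ?z + ((1 - t) * c + t * d) *\<^sub>R u)"
      using closed_log_concave_levels [OF f, of t "?g x" "?g y" "x + c *\<^sub>R u" "y + d *\<^sub>R u"]
        closed_log_concave_levels [OF f, of t "?g x" "?g y" "reflect u x + c *\<^sub>R u" "reflect u y + d *\<^sub>R u"]
        t c d by simp_all
    then show ?thesis using t by (subst lev') auto
  qed
  moreover have "0 < ?g 0"
  proof -
    have "f 0 \<le> ?g 0"
      using f0 by (subst lev' [OF f0], intro exI [of _ 0]) (simp add: reflect_def)
    then show ?thesis using f0 by simp
  qed
  moreover obtain s where "0 < s" "0 < emeasure lborel {x. s \<le> f x}"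
    using f by (auto simp: closed_log_concave_def)
  then have "0 < s \<and> 0 < emeasure lborel {x. s \<le> ?g x}"
    using emeasure_steiner_set [OF u cpt convex_level [OF f]] by (simp add: lev)
  moreover have "0 \<le> ?g x" for x by (rule steiner_fun_levels(1) [OF u cpt])
  ultimately show ?thesis
    unfolding closed_log_concave_def using compact_steiner_set [OF u cpt] by (auto simp: lev)
qed

section \<open>The symmetric decreasing rearrangement\<close>

text \<open>The value \<open>- 1\<close> makes the closed ball of this radius empty for the empty
set, while a nonempty null set gets radius \<open>0\<close>, so that the ball is the origin
alone.\<close>
definition volume_radius :: "'a::euclidean_space set \<Rightarrow> real" where
  "volume_radius A = (if A = {} then - 1
     else root DIM('a) (measure lborel A / unit_ball_vol (real DIM('a))))"

lemma emeasure_compact_eq_measure: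
  fixes A :: "'a::euclidean_space set"
  assumes "compact A"
  shows "emeasure lborel A = ennreal (measure lborel A)"
  using emeasure_compact_finite [OF assms] by (simp add: emeasure_eq_ennreal_measure less_top)

lemma volume_radius_nonneg_iff: "0 \<le> volume_radius A \<longleftrightarrow> A \<noteq> {}"
  by (auto simp: volume_radius_def unit_ball_vol_nonneg)

lemma emeasure_cball_volume_radius:
  fixes A :: "'a::euclidean_space set"
  assumes "compact A"
  shows "emeasure lborel (cball (0::'a) (volume_radius A)) = emeasure lborel A"
proof (cases "A = {}")
  case False
  have b: "unit_ball_vol (real DIM('a)) \<noteq> 0" "0 \<le> unit_ball_vol (real DIM('a))"
    using unit_ball_vol_pos [of "real DIM('a)"] by linarith+
  have "volume_radius A ^ DIM('a) = measure lborel A / unit_ball_vol (real DIM('a))"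
    using False b by (simp add: volume_radius_def real_root_pow_pos2)
  then show ?thesis
    using False b volume_radius_nonneg_iff [of A] emeasure_compact_eq_measure [OF assms]
    by (simp add: emeasure_cball)
qed (simp add: volume_radius_def)

lemma emeasure_cball_le_iff:
  fixes a b :: real
  assumes "0 \<le> a" "0 \<le> b"
  shows "emeasure lborel (cball (0::'a::euclidean_space) a) \<le> emeasure lborel (cball (0::'a) b) \<longleftrightarrow> a \<le> b"
proof -
  have "0 < unit_ball_vol (real DIM('a))" by simp
  then show ?thesis
    using assms by (simp add: emeasure_cball power_mono_iff)
qed

lemma cball_volume_radius_mono:
  fixes A B :: "'a::euclidean_space set"
  assumes "compact A" "compact B" "A \<subseteq> B"
  shows "cball (0::'a) (volume_radius A) \<subseteq> cball 0 (volume_radius B)"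
proof (cases "A = {}")
  case False
  then have "0 \<le> volume_radius A" "0 \<le> volume_radius B"
    using assms by (auto simp: volume_radius_nonneg_iff)
  moreover have "emeasure lborel A \<le> emeasure lborel B"
    using assms by (intro emeasure_mono) (auto simp: borel_compact)
  ultimately have "volume_radius A \<le> volume_radius B"
    using assms by (simp add: emeasure_cball_volume_radius flip: emeasure_cball_le_iff [where 'a = 'a])
  then show ?thesis by auto
qed (simp add: volume_radius_def)

lemma volume_radius_cball: "0 \<le> R \<Longrightarrow> volume_radius (cball (0::'a::euclidean_space) R) = R"
  using emeasure_cball_volume_radius [of "cball (0::'a) R"] volume_radius_nonneg_iff [of "cball (0::'a) R"]
  by (intro antisym) (simp_all flip: emeasure_cball_le_iff [where 'a = 'a])

lemma cball_volume_radius_subset: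
  fixes A :: "'a::euclidean_space set"
  assumes "compact A" "A \<subseteq> cball 0 R"
  shows "cball (0::'a) (volume_radius A) \<subseteq> cball 0 R"
proof (cases "0 \<le> R")
  case True
  then show ?thesis using cball_volume_radius_mono [OF assms(1) compact_cball assms(2)]
    by (simp add: volume_radius_cball)
next
  case False
  then have "A = {}" using assms(2) by auto
  then show ?thesis by (simp add: volume_radius_def)
qed

lemma volume_radius_eq:
  fixes A :: "'a::euclidean_space set"
  assumes "compact A" "A \<noteq> {}" "0 \<le> r" "emeasure lborel (cball (0::'a) r) = emeasure lborel A"
  shows "r = volume_radius A"
  using emeasure_cball_volume_radius [OF assms(1)] volume_radius_nonneg_iff [of A] assms
  by (intro antisym) (simp_all flip: emeasure_cball_le_iff [where 'a = 'a])

definition symmetric_rearrangement :: "('a::euclidean_space \<Rightarrow> real) \<Rightarrow> 'a \<Rightarrow> real" where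
  "symmetric_rearrangement f = from_levels (\<lambda>s. cball 0 (volume_radius {z. s \<le> f z}))"

text \<open>Left continuity of the radii is continuity from above of the Lebesgue measure on the
nested compact level sets.\<close>
lemma symmetric_rearrangement_levels:
  fixes f :: "'a::euclidean_space \<Rightarrow> real"
  assumes f: "\<And>s. 0 < s \<Longrightarrow> compact {x. s \<le> f x}"
  shows "0 \<le> symmetric_rearrangement f x"
    and "0 < s \<Longrightarrow> {x. s \<le> symmetric_rearrangement f x} = cball 0 (volume_radius {x. s \<le> f x})"
proof -
  obtain M where M: "0 < M" "\<And>x. f x < M" using bounded_above_compact_levels [of f] f by blast
  then have empty: "{z. M \<le> f z} = {}" by (auto simp: not_le)
  have mono: "cball (0::'a) (volume_radius {z. t \<le> f z}) \<subseteq> cball 0 (volume_radius {z. s \<le> f z})"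
    if "0 < s" "s \<le> t" for s t
    using that by (intro cball_volume_radius_mono f) auto
  have cont: "x \<in> cball 0 (volume_radius {z. s \<le> f z})"
    if s: "0 < s" and x: "\<And>s'. 0 < s' \<Longrightarrow> s' < s \<Longrightarrow> x \<in> cball 0 (volume_radius {z. s' \<le> f z})" for s and x :: 'a
  proof -
    have le: "norm x \<le> volume_radius {z. s' \<le> f z}" if "0 < s'" "s' < s" for s'
      using x [OF that] by simp
    have "\<exists>z. s' \<le> f z \<and> True" if "0 < s'" "s' < s" for s'
      using le [OF that] volume_radius_nonneg_iff [of "{z. s' \<le> f z}"] order_trans [OF norm_ge_zero]
      by fastforce
    then have "\<exists>z. s \<le> f z \<and> True"
      by - (rule level_nonempty_from_below [OF f s], auto)
    then have ne: "0 \<le> volume_radius {z. s \<le> f z}"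
      by (auto simp: volume_radius_nonneg_iff)
    define r where "r n = s - s / (real n + 2)" for n :: nat
    have r: "0 < r n" "r n < s" for n using s by (auto simp: r_def field_simps add_pos_nonneg)
    have "r \<longlonglongrightarrow> s - 0" unfolding r_def by (intro tendsto_intros) real_asymp
    then have rs: "r \<longlonglongrightarrow> s" by simp
    have "(\<lambda>n. emeasure lborel {z. r n \<le> f z}) \<longlonglongrightarrow> emeasure lborel (\<Inter>n. {z. r n \<le> f z})"
    proof (rule Lim_emeasure_decseq)
      show "range (\<lambda>n. {z. r n \<le> f z}) \<subseteq> sets lborel" using f r by (auto simp: borel_compact)
      show "emeasure lborel {z. r n \<le> f z} \<noteq> \<infinity>" for n
        using emeasure_compact_finite [OF f [OF r(1)]] by (simp add: less_top)
      show "decseq (\<lambda>n. {z. r n \<le> f z})"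
      proof (rule decseq_SucI, clarify)
        fix n x assume "r (Suc n) \<le> f x"
        moreover have "r n \<le> r (Suc n)" using s by (simp add: r_def frac_le)
        ultimately show "r n \<le> f x" by simp
      qed
    qed
    also have "(\<Inter>n. {z. r n \<le> f z}) = {z. s \<le> f z}"
    proof (intro set_eqI iffI)
      fix z assume "z \<in> (\<Inter>n. {z. r n \<le> f z})"
      then show "z \<in> {z. s \<le> f z}"
        using rs by (auto intro: LIMSEQ_le_const2)
    next
      fix z assume "z \<in> {z. s \<le> f z}"
      then show "z \<in> (\<Inter>n. {z. r n \<le> f z})" using r(2) by (auto intro: order_trans [OF less_imp_le])
    qed
    finally have lim: "(\<lambda>n. emeasure lborel {z. r n \<le> f z}) \<longlonglongrightarrow> emeasure lborel {z. s \<le> f z}" .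
    have "emeasure lborel (cball (0::'a) (norm x)) \<le> emeasure lborel {z. r n \<le> f z}" for n
    proof -
      have "emeasure lborel (cball (0::'a) (norm x)) \<le> emeasure lborel (cball (0::'a) (volume_radius {z. r n \<le> f z}))"
        using le [OF r(1) [of n] r(2) [of n]] by (intro emeasure_mono) auto
      then show ?thesis by (simp add: emeasure_cball_volume_radius f r)
    qed
    then have "emeasure lborel (cball (0::'a) (norm x)) \<le> emeasure lborel {z. s \<le> f z}"
      by (intro LIMSEQ_le_const [OF lim]) auto
    then have "emeasure lborel (cball (0::'a) (norm x)) \<le> emeasure lborel (cball (0::'a) (volume_radius {z. s \<le> f z}))"
      by (simp add: emeasure_cball_volume_radius f s)
    then show ?thesis using ne by (simp add: emeasure_cball_le_iff)
  qed
  have K: "cball 0 (volume_radius {z. M \<le> f z}) = {}" by (simp add: empty volume_radius_def)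
  show "0 \<le> symmetric_rearrangement f x"
    unfolding symmetric_rearrangement_def
    by (rule from_levels(1) [where M = M]) (use mono cont M(1) K in auto)
  show "0 < s \<Longrightarrow> {x. s \<le> symmetric_rearrangement f x} = cball 0 (volume_radius {x. s \<le> f x})"
    unfolding symmetric_rearrangement_def
    by (rule from_levels(2) [where M = M]) (use mono cont M(1) K in auto)
qed

section \<open>Overlap of functions and its gain under symmetrization\<close>

lemma layer_cake:
  fixes k :: "'a::euclidean_space \<Rightarrow> real"
  assumes [measurable]: "k \<in> borel_measurable borel" and k0: "\<And>x. 0 \<le> k x"
  shows "(\<integral>\<^sup>+x. ennreal (k x) \<partial>lborel) = (\<integral>\<^sup>+s. indicator {0<..} s * emeasure lborel {x. s \<le> k x} \<partial>lborel)"
proof -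
  have "(\<integral>\<^sup>+x. ennreal (k x) \<partial>lborel) = (\<integral>\<^sup>+x. (\<integral>\<^sup>+s. indicator {s. 0 < s \<and> s \<le> k x} s \<partial>lborel) \<partial>lborel)"
  proof (rule nn_integral_cong)
    fix x
    have "{s. 0 < s \<and> s \<le> k x} = {0<..k x}" by auto
    then show "ennreal (k x) = (\<integral>\<^sup>+s. indicator {s. 0 < s \<and> s \<le> k x} s \<partial>lborel)"
      using k0 by simp
  qed
  also have "\<dots> = (\<integral>\<^sup>+s. (\<integral>\<^sup>+x. indicator {s. 0 < s \<and> s \<le> k x} s \<partial>lborel) \<partial>lborel)"
    by (rule lborel_pair.Fubini') measurable
  also have "\<dots> = (\<integral>\<^sup>+s. indicator {0<..} s * emeasure lborel {x. s \<le> k x} \<partial>lborel)"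
  proof (rule nn_integral_cong)
    fix s :: real
    have "(\<integral>\<^sup>+x. indicator {s. 0 < s \<and> s \<le> k x} s \<partial>lborel) = (\<integral>\<^sup>+x. indicator {0<..} s * indicator {x. s \<le> k x} x \<partial>lborel)"
      by (rule nn_integral_cong) (auto simp: indicator_def)
    also have "\<dots> = indicator {0<..} s * emeasure lborel {x. s \<le> k x}"
      by (rule nn_integral_cmult_indicator) measurable
    finally show "(\<integral>\<^sup>+x. indicator {s. 0 < s \<and> s \<le> k x} s \<partial>lborel) = indicator {0<..} s * emeasure lborel {x. s \<le> k x}" .
  qed
  finally show ?thesis .
qed

lemma measurable_emeasure_slice:
  fixes P :: "'a::euclidean_space \<Rightarrow> real \<Rightarrow> bool"
  assumes [measurable]: "Measurable.pred (borel \<Otimes>\<^sub>M borel) (\<lambda>p. P (fst p) (snd p))"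
  shows "(\<lambda>s. emeasure lborel {x. P x s}) \<in> borel_measurable borel"
proof -
  have P [measurable]: "Measurable.pred borel (\<lambda>x. P x s)" for s
    using measurable_compose [OF _ assms, of "\<lambda>x. (x, s)" borel] by simp
  have "(\<lambda>s. \<integral>\<^sup>+x. indicator {p. P (fst p) (snd p)} (x, s) \<partial>lborel) \<in> borel_measurable borel"
    by (intro lborel.borel_measurable_nn_integral) measurable
  moreover have "(\<integral>\<^sup>+x. indicator {p. P (fst p) (snd p)} (x, s) \<partial>lborel) = emeasure lborel {x. P x s}" for s
  proof -
    have "(\<integral>\<^sup>+x. indicator {p. P (fst p) (snd p)} (x, s) \<partial>lborel) = (\<integral>\<^sup>+x. indicator {x. P x s} x \<partial>lborel)"
      by (rule nn_integral_cong) (auto simp: indicator_def)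
    also have "\<dots> = emeasure lborel {x. P x s}" by (rule nn_integral_indicator) measurable
    finally show ?thesis .
  qed
  ultimately show ?thesis by simp
qed

text \<open>For two functions of equal integral \<open>I\<close> the \<open>L\<^sup>1\<close>
distance is \<open>2 * (I - overlap)\<close>; the overlap is easier to control because it is the
integral over \<open>s\<close> of the volume shared by the level sets.\<close>
definition overlap :: "('a::euclidean_space \<Rightarrow> real) \<Rightarrow> ('a \<Rightarrow> real) \<Rightarrow> ennreal" where
  "overlap h g = (\<integral>\<^sup>+x. ennreal (min (h x) (g x)) \<partial>lborel)"

lemma overlap_layers:
  fixes h g :: "'a::euclidean_space \<Rightarrow> real"
  assumes [measurable]: "h \<in> borel_measurable borel" "g \<in> borel_measurable borel"
    and "\<And>x. 0 \<le> h x" "\<And>x. 0 \<le> g x"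
  shows "overlap h g = (\<integral>\<^sup>+s. indicator {0<..} s * emeasure lborel ({x. s \<le> h x} \<inter> {x. s \<le> g x}) \<partial>lborel)"
  unfolding overlap_def
  by (subst layer_cake) (use assms in \<open>auto simp: Collect_conj_eq\<close>)

text \<open>The gain of each pair of level sets, integrated over the levels. Only the gain at
levels in \<open>[\<epsilon>, M]\<close> is recorded: superlevel sets at heights above \<open>\<epsilon>\<close>
lie in one common ball, which will bound the relevant translations.\<close>
lemma overlap_steiner_gain:
  fixes h g :: "'a::euclidean_space \<Rightarrow> real"
  assumes u: "norm u = 1" and h: "closed_log_concave h"
    and g0: "\<And>x. 0 \<le> g x" and g: "\<And>s. 0 < s \<Longrightarrow> {x. s \<le> g x} = cball 0 (\<rho> s)" and \<epsilon>: "0 < \<epsilon>"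
  shows "overlap h g + (\<integral>\<^sup>+s. indicator {\<epsilon>..M} s * emeasure lborel
            {x. (g x < s \<and> s \<le> h x) \<and> (h (x + \<tau> *\<^sub>R u) < s \<and> s \<le> g (x + \<tau> *\<^sub>R u))} \<partial>lborel)
      \<le> overlap (steiner_fun u h) g"
proof -
  have cpt: "\<And>s. 0 < s \<Longrightarrow> compact {x. s \<le> h x}" and h0: "\<And>x. 0 \<le> h x"
    using h by (auto simp: closed_log_concave_def)
  have Sh: "closed_log_concave (steiner_fun u h)" by (rule closed_log_concave_steiner_fun [OF u h])
  have [measurable]: "h \<in> borel_measurable borel" "steiner_fun u h \<in> borel_measurable borel"
    using h Sh by (auto intro: borel_measurable_closed_log_concave)
  have [measurable]: "g \<in> borel_measurable borel"
    by (rule borel_measurable_compact_levels) (auto simp: g0 g)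
  have [measurable]: "(\<lambda>s. emeasure lborel ({x. s \<le> h x} \<inter> {x. s \<le> g x})) \<in> borel_measurable borel"
    unfolding Collect_conj_eq [symmetric] by (rule measurable_emeasure_slice) measurable
  have [measurable]: "(\<lambda>s. emeasure lborel {x. (g x < s \<and> s \<le> h x) \<and>
      (h (x + \<tau> *\<^sub>R u) < s \<and> s \<le> g (x + \<tau> *\<^sub>R u))}) \<in> borel_measurable borel"
    by (rule measurable_emeasure_slice) measurable
  have "overlap h g + (\<integral>\<^sup>+s. indicator {\<epsilon>..M} s * emeasure lborel
            {x. (g x < s \<and> s \<le> h x) \<and> (h (x + \<tau> *\<^sub>R u) < s \<and> s \<le> g (x + \<tau> *\<^sub>R u))} \<partial>lborel)
      = (\<integral>\<^sup>+s. indicator {0<..} s * emeasure lborel ({x. s \<le> h x} \<inter> {x. s \<le> g x})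
          + indicator {\<epsilon>..M} s * emeasure lborel
            {x. (g x < s \<and> s \<le> h x) \<and> (h (x + \<tau> *\<^sub>R u) < s \<and> s \<le> g (x + \<tau> *\<^sub>R u))} \<partial>lborel)"
    by (subst overlap_layers) (auto simp: h0 g0 intro!: nn_integral_add [symmetric])
  also have "\<dots> \<le> (\<integral>\<^sup>+s. indicator {0<..} s * emeasure lborel ({x. s \<le> steiner_fun u h x} \<inter> {x. s \<le> g x}) \<partial>lborel)"
  proof (rule nn_integral_mono)
    fix s :: real
    show "indicator {0<..} s * emeasure lborel ({x. s \<le> h x} \<inter> {x. s \<le> g x})
          + indicator {\<epsilon>..M} s * emeasure lborel
            {x. (g x < s \<and> s \<le> h x) \<and> (h (x + \<tau> *\<^sub>R u) < s \<and> s \<le> g (x + \<tau> *\<^sub>R u))}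
        \<le> indicator {0<..} s * emeasure lborel ({x. s \<le> steiner_fun u h x} \<inter> {x. s \<le> g x})"
    proof (cases "0 < s")
      case True
      let ?A = "{x. s \<le> h x}" and ?B = "{x. s \<le> g x}"
      have W: "{x. (g x < s \<and> s \<le> h x) \<and> (h (x + \<tau> *\<^sub>R u) < s \<and> s \<le> g (x + \<tau> *\<^sub>R u))}
          = {x. x \<in> ?A - ?B \<and> x + \<tau> *\<^sub>R u \<in> ?B - ?A}" by auto
      have "emeasure lborel (?A \<inter> ?B) + emeasure lborel {x. x \<in> ?A - ?B \<and> x + \<tau> *\<^sub>R u \<in> ?B - ?A}
          \<le> emeasure lborel (steiner_set u ?A \<inter> ?B)"
        unfolding g [OF True] by (rule steiner_set_overlap [OF u cpt [OF True] convex_level [OF h True]])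
      then have le: "emeasure lborel (?A \<inter> ?B) + emeasure lborel {x. x \<in> ?A - ?B \<and> x + \<tau> *\<^sub>R u \<in> ?B - ?A}
          \<le> emeasure lborel ({x. s \<le> steiner_fun u h x} \<inter> ?B)"
        using steiner_fun_levels(2) [OF u cpt True] by simp
      have "indicator {\<epsilon>..M} s * emeasure lborel {x. x \<in> ?A - ?B \<and> x + \<tau> *\<^sub>R u \<in> ?B - ?A}
          \<le> emeasure lborel {x. x \<in> ?A - ?B \<and> x + \<tau> *\<^sub>R u \<in> ?B - ?A}"
        by (simp split: split_indicator)
      with True show ?thesis unfolding W
        by (auto intro: order_trans [OF add_left_mono le])
    qed (use \<epsilon> in \<open>auto simp: indicator_def\<close>)
  qed
  also have "\<dots> = overlap (steiner_fun u h) g"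
    by (subst overlap_layers) (use Sh in \<open>auto simp: g0 closed_log_concave_def\<close>)
  finally show ?thesis .
qed

text \<open>By Fubini and translation invariance: each point of \<open>P\<close> at level \<open>s\<close> is
counted for exactly those \<open>v\<close> that carry it into \<open>Q\<close>.\<close>
lemma integral_shifted_intersections:
  fixes P Q :: "'a::euclidean_space \<Rightarrow> real \<Rightarrow> bool" and w :: "real \<Rightarrow> ennreal"
  assumes P [measurable]: "Measurable.pred (borel \<Otimes>\<^sub>M borel) (\<lambda>p. P (fst p) (snd p))"
    and Q [measurable]: "Measurable.pred (borel \<Otimes>\<^sub>M borel) (\<lambda>p. Q (fst p) (snd p))"
    and w [measurable]: "w \<in> borel_measurable borel"
  shows "(\<integral>\<^sup>+v. (\<integral>\<^sup>+s. w s * emeasure lborel {x. P x s \<and> Q (x + v) s} \<partial>lborel) \<partial>lborel)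
    = (\<integral>\<^sup>+s. w s * (emeasure lborel {x. P x s} * emeasure lborel {x. Q x s}) \<partial>lborel)"
proof -
  let ?p = "\<lambda>x s. indicator {p. P (fst p) (snd p)} (x, s) :: ennreal"
  let ?q = "\<lambda>x s. indicator {p. Q (fst p) (snd p)} (x, s) :: ennreal"
  have Ps [measurable]: "Measurable.pred borel (\<lambda>x. P x s)" for s
    using measurable_compose [OF _ P, of "\<lambda>x. (x, s)" borel] by simp
  have Qs [measurable]: "Measurable.pred borel (\<lambda>x. Q x s)" for s
    using measurable_compose [OF _ Q, of "\<lambda>x. (x, s)" borel] by simp
  have [measurable]: "(\<lambda>p. indicator {p. P (fst p) (snd p)} p :: ennreal) \<in> borel_measurable (borel \<Otimes>\<^sub>M borel)"
    "(\<lambda>p. indicator {p. Q (fst p) (snd p)} p :: ennreal) \<in> borel_measurable (borel \<Otimes>\<^sub>M borel)" by measurable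
  have e: "emeasure lborel {x. P x s \<and> Q (x + v) s} = (\<integral>\<^sup>+x. ?p x s * ?q (x + v) s \<partial>lborel)" for s v
  proof -
    have "(\<integral>\<^sup>+x. ?p x s * ?q (x + v) s \<partial>lborel) = (\<integral>\<^sup>+x. indicator {x. P x s \<and> Q (x + v) s} x \<partial>lborel)"
      by (rule nn_integral_cong) (auto simp: indicator_def)
    also have "\<dots> = emeasure lborel {x. P x s \<and> Q (x + v) s}"
      by (rule nn_integral_indicator) measurable
    finally show ?thesis by simp
  qed
  have eP: "emeasure lborel {x. P x s} = (\<integral>\<^sup>+x. ?p x s \<partial>lborel)" for s
  proof -
    have "emeasure lborel {x. P x s} = (\<integral>\<^sup>+x. indicator {x. P x s} x \<partial>lborel)"
      by (rule nn_integral_indicator [symmetric]) measurable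
    then show ?thesis by (simp add: indicator_def)
  qed
  have eQ: "emeasure lborel {x. Q x s} = (\<integral>\<^sup>+x. ?q x s \<partial>lborel)" for s
  proof -
    have "emeasure lborel {x. Q x s} = (\<integral>\<^sup>+x. indicator {x. Q x s} x \<partial>lborel)"
      by (rule nn_integral_indicator [symmetric]) measurable
    then show ?thesis by (simp add: indicator_def)
  qed
  have "(\<integral>\<^sup>+v. (\<integral>\<^sup>+s. w s * (\<integral>\<^sup>+x. ?p x s * ?q (x + v) s \<partial>lborel) \<partial>lborel) \<partial>lborel)
      = (\<integral>\<^sup>+s. (\<integral>\<^sup>+v. w s * (\<integral>\<^sup>+x. ?p x s * ?q (x + v) s \<partial>lborel) \<partial>lborel) \<partial>lborel)"
    by (rule lborel_pair.Fubini') measurable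
  also have "\<dots> = (\<integral>\<^sup>+s. w s * (emeasure lborel {x. P x s} * emeasure lborel {x. Q x s}) \<partial>lborel)"
  proof (rule nn_integral_cong)
    fix s :: real
    have "(\<integral>\<^sup>+v. w s * (\<integral>\<^sup>+x. ?p x s * ?q (x + v) s \<partial>lborel) \<partial>lborel)
        = w s * (\<integral>\<^sup>+v. (\<integral>\<^sup>+x. ?p x s * ?q (x + v) s \<partial>lborel) \<partial>lborel)"
      by (rule nn_integral_cmult) measurable
    also have "(\<integral>\<^sup>+v. (\<integral>\<^sup>+x. ?p x s * ?q (x + v) s \<partial>lborel) \<partial>lborel)
        = (\<integral>\<^sup>+x. (\<integral>\<^sup>+v. ?p x s * ?q (x + v) s \<partial>lborel) \<partial>lborel)"
      by (rule lborel_pair.Fubini') measurable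
    also have "\<dots> = (\<integral>\<^sup>+x. ?p x s * emeasure lborel {x. Q x s} \<partial>lborel)"
    proof (rule nn_integral_cong)
      fix x :: 'a
      have "(\<integral>\<^sup>+v. ?p x s * ?q (x + v) s \<partial>lborel) = ?p x s * (\<integral>\<^sup>+v. ?q (x + v) s \<partial>lborel)"
        by (rule nn_integral_cmult) measurable
      also have "(\<integral>\<^sup>+v. ?q (x + v) s \<partial>lborel) = (\<integral>\<^sup>+v. ?q v s \<partial>lborel)"
        using nn_integral_lborel_shift [of "\<lambda>v. ?q v s" x] by (simp add: add.commute)
      finally show "(\<integral>\<^sup>+v. ?p x s * ?q (x + v) s \<partial>lborel) = ?p x s * emeasure lborel {x. Q x s}"
        by (simp add: eQ)
    qed
    also have "\<dots> = emeasure lborel {x. P x s} * emeasure lborel {x. Q x s}"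
      by (subst nn_integral_multc) (auto simp: eP)
    finally show "(\<integral>\<^sup>+v. w s * (\<integral>\<^sup>+x. ?p x s * ?q (x + v) s \<partial>lborel) \<partial>lborel)
        = w s * (emeasure lborel {x. P x s} * emeasure lborel {x. Q x s})" .
  qed
  finally show ?thesis by (simp add: e)
qed

section \<open>Convergence of iterated symmetrals\<close>

inductive_set steiner_orbit :: "('a::euclidean_space \<Rightarrow> real) \<Rightarrow> ('a \<Rightarrow> real) set"
  for f :: "'a \<Rightarrow> real" where
  start: "f \<in> steiner_orbit f"
| step: "h \<in> steiner_orbit f \<Longrightarrow> norm u = 1 \<Longrightarrow> steiner_fun u h \<in> steiner_orbit f"

lemma steiner_orbit_closed_log_concave:
  "h \<in> steiner_orbit f \<Longrightarrow> closed_log_concave f \<Longrightarrow> closed_log_concave h"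
  by (induction rule: steiner_orbit.induct) (auto intro: closed_log_concave_steiner_fun)

lemma compact_level: "closed_log_concave f \<Longrightarrow> 0 < s \<Longrightarrow> compact {x. s \<le> f x}"
  and closed_log_concave_nonneg: "closed_log_concave f \<Longrightarrow> 0 \<le> f x"
  by (auto simp: closed_log_concave_def)

lemma steiner_orbit_equimeasurable:
  assumes "h \<in> steiner_orbit f" "closed_log_concave f" "0 < s"
  shows "emeasure lborel {x. s \<le> h x} = emeasure lborel {x. s \<le> f x}"
  using assms(1)
proof induction
  case (step h u)
  have h: "closed_log_concave h" by (rule steiner_orbit_closed_log_concave [OF step(1) assms(2)])
  then show ?case
    using step(2,3) assms(3)
    by (simp add: steiner_fun_levels(2) compact_level emeasure_steiner_set convex_level)
qed simp

lemma steiner_orbit_level_subset_cball: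
  assumes "h \<in> steiner_orbit f" "closed_log_concave f" "0 < s" "{x. s \<le> f x} \<subseteq> cball 0 R"
  shows "{x. s \<le> h x} \<subseteq> cball 0 R"
  using assms(1)
proof induction
  case (step h u)
  have h: "closed_log_concave h" by (rule steiner_orbit_closed_log_concave [OF step(1) assms(2)])
  then show ?case
    using steiner_set_subset_cball [OF step(2) step(3)] step(2) assms(3)
    by (simp add: steiner_fun_levels(2) compact_level)
qed (rule assms(4))

lemma steiner_orbit_integral:
  assumes "h \<in> steiner_orbit f" "closed_log_concave f"
  shows "(\<integral>\<^sup>+x. ennreal (h x) \<partial>lborel) = (\<integral>\<^sup>+x. ennreal (f x) \<partial>lborel)"
proof -
  have "closed_log_concave h" by (rule steiner_orbit_closed_log_concave [OF assms])
  with assms show ?thesis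
    by (auto simp: layer_cake borel_measurable_closed_log_concave closed_log_concave_nonneg
        steiner_orbit_equimeasurable intro!: nn_integral_cong split: split_indicator)
qed

lemma symmetric_rearrangement_equimeasurable:
  assumes "closed_log_concave f" "0 < s"
  shows "emeasure lborel {x. s \<le> symmetric_rearrangement f x} = emeasure lborel {x. s \<le> f x}"
  using assms by (simp add: symmetric_rearrangement_levels(2) compact_level emeasure_cball_volume_radius)

lemma borel_measurable_symmetric_rearrangement:
  assumes f: "closed_log_concave f"
  shows "symmetric_rearrangement f \<in> borel_measurable borel"
  by (rule borel_measurable_compact_levels)
    (simp_all add: symmetric_rearrangement_levels compact_level [OF f])

lemma symmetric_rearrangement_integral:
  assumes "closed_log_concave f"
  shows "(\<integral>\<^sup>+x. ennreal (symmetric_rearrangement f x) \<partial>lborel) = (\<integral>\<^sup>+x. ennreal (f x) \<partial>lborel)"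
proof -
  have "(\<integral>\<^sup>+x. ennreal (symmetric_rearrangement f x) \<partial>lborel)
      = (\<integral>\<^sup>+s. indicator {0<..} s * emeasure lborel {x. s \<le> symmetric_rearrangement f x} \<partial>lborel)"
    using assms by (intro layer_cake borel_measurable_symmetric_rearrangement symmetric_rearrangement_levels(1) compact_level)
  also have "\<dots> = (\<integral>\<^sup>+s. indicator {0<..} s * emeasure lborel {x. s \<le> f x} \<partial>lborel)"
    using assms by (auto simp: symmetric_rearrangement_equimeasurable intro!: nn_integral_cong split: split_indicator)
  also have "\<dots> = (\<integral>\<^sup>+x. ennreal (f x) \<partial>lborel)"
    using assms by (intro layer_cake [symmetric] borel_measurable_closed_log_concave closed_log_concave_nonneg)
  finally show ?thesis .
qed

lemma small_truncation:
  fixes f :: "'a::euclidean_space \<Rightarrow> real"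
  assumes f: "closed_log_concave f" and \<eta>: "(0::real) < \<eta>"
  obtains \<epsilon> where "0 < \<epsilon>" "(\<integral>\<^sup>+x. ennreal (min (f x) \<epsilon>) \<partial>lborel) < ennreal \<eta>"
proof -
  have [measurable]: "f \<in> borel_measurable borel" by (rule borel_measurable_closed_log_concave [OF f])
  have "(\<lambda>n. \<integral>\<^sup>+x. ennreal (min (f x) (1 / real (Suc n))) \<partial>lborel) \<longlonglongrightarrow> (\<integral>\<^sup>+x. 0 \<partial>(lborel :: 'a measure))"
  proof (rule nn_integral_dominated_convergence [where w = "\<lambda>x. ennreal (f x)"])
    show "AE x in lborel. (\<lambda>n. ennreal (min (f x) (1 / real (Suc n)))) \<longlonglongrightarrow> 0"
    proof (rule AE_I2)
      fix x :: 'a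
      have "(\<lambda>n. min (f x) (1 / real (Suc n))) \<longlonglongrightarrow> min (f x) 0"
        by (intro tendsto_min tendsto_const LIMSEQ_Suc [OF lim_1_over_n])
      then have "(\<lambda>n. ennreal (min (f x) (1 / real (Suc n)))) \<longlonglongrightarrow> ennreal (min (f x) 0)"
        by (rule tendsto_ennrealI)
      then show "(\<lambda>n. ennreal (min (f x) (1 / real (Suc n)))) \<longlonglongrightarrow> 0"
        using closed_log_concave_nonneg [OF f] by (simp add: min_absorb2)
    qed
  qed (use closed_log_concave_integral_finite [OF f] in \<open>auto intro!: ennreal_leI\<close>)
  then have "eventually (\<lambda>n. (\<integral>\<^sup>+x. ennreal (min (f x) (1 / real (Suc n))) \<partial>lborel) < ennreal \<eta>) sequentially"
    by (rule order_tendstoD) (use \<eta> in simp)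
  then obtain n where "(\<integral>\<^sup>+x. ennreal (min (f x) (1 / real (Suc n))) \<partial>lborel) < ennreal \<eta>"
    by (auto simp: eventually_sequentially)
  then show ?thesis by (intro that [of "1 / real (Suc n)"]) auto
qed

text \<open>The tangent line bound for the square; integrated with the right slope, it gives the
Cauchy--Schwarz lower bound for the integral of \<open>p\<^sup>2\<close>.\<close>
lemma ennreal_square_tangent:
  fixes \<kappa> :: real and p :: ennreal
  assumes "0 \<le> \<kappa>"
  shows "ennreal (2 * \<kappa>) * p \<le> p * p + ennreal (\<kappa> * \<kappa>)"
proof (cases p)
  case (real r)
  have "2 * \<kappa> * r \<le> r * r + \<kappa> * \<kappa>"
    using zero_le_square [of "r - \<kappa>"] by (simp add: algebra_simps)
  then have "ennreal (2 * \<kappa> * r) \<le> ennreal (r * r + \<kappa> * \<kappa>)" by (rule ennreal_leI)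
  then show ?thesis using real assms by (simp add: ennreal_mult ennreal_plus)
qed (simp add: ennreal_top_mult)

text \<open>As long as the overlap with the rearrangement \<open>g\<close> falls short of the
integral by \<open>\<eta>\<close>, some symmetrization gains an amount \<open>\<gamma>\<close> that
does not depend on the member \<open>h\<close> of the orbit. Let \<open>p s\<close> be the volume by
which the level sets of \<open>h\<close> and \<open>g\<close> at height \<open>s\<close> differ in
one direction; by equimeasurability it is the same in the other direction. The integral of
\<open>p\<close> is the missing overlap, and levels below \<open>\<epsilon>\<close> contribute at
most half of \<open>\<eta>\<close>. Integrating the gain over the translations \<open>v\<close> of
norm at most \<open>2 * R\<close>, which are the only ones that matter, yields the integral of
\<open>p\<^sup>2\<close>, and this is bounded below by the Cauchy--Schwarz inequality. Hence some
\<open>v\<close> is at least as good as the average, and its direction is the one to symmetrize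
in.\<close>
lemma steiner_orbit_uniform_gain:
  fixes f :: "'a::euclidean_space \<Rightarrow> real"
  assumes f: "closed_log_concave f" and \<eta>: "(0::real) < \<eta>"
  defines "g \<equiv> symmetric_rearrangement f"
  obtains \<gamma> :: real where "0 < \<gamma>"
    "\<And>h. h \<in> steiner_orbit f \<Longrightarrow> overlap h g + ennreal \<eta> \<le> (\<integral>\<^sup>+x. ennreal (f x) \<partial>lborel)
      \<Longrightarrow> \<exists>u. norm u = 1 \<and> overlap h g + ennreal \<gamma> \<le> overlap (steiner_fun u h) g"
proof -
  let ?I = "\<integral>\<^sup>+x. ennreal (f x) \<partial>lborel"
  have I: "?I < \<infinity>" by (rule closed_log_concave_integral_finite [OF f])
  have [measurable]: "f \<in> borel_measurable borel" and gm [measurable]: "g \<in> borel_measurable borel"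
    unfolding g_def by (auto intro: borel_measurable_closed_log_concave borel_measurable_symmetric_rearrangement f)
  have f0: "\<And>x. 0 \<le> f x" by (rule closed_log_concave_nonneg [OF f])
  have g0: "\<And>x. 0 \<le> g x" unfolding g_def by (rule symmetric_rearrangement_levels(1) [OF compact_level [OF f]])
  have g: "\<And>s. 0 < s \<Longrightarrow> {x. s \<le> g x} = cball 0 (volume_radius {x. s \<le> f x})"
    unfolding g_def by (rule symmetric_rearrangement_levels(2) [OF compact_level [OF f]])
  obtain \<epsilon> where \<epsilon>: "0 < \<epsilon>" "(\<integral>\<^sup>+x. ennreal (min (f x) \<epsilon>) \<partial>lborel) < ennreal (\<eta> / 2)"
    using small_truncation [OF f, of "\<eta> / 2"] \<eta> by auto
  obtain M where M: "0 < M" "\<And>x. f x < M" using bounded_above_compact_levels [OF compact_level [OF f]] by blast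
  obtain R0 where R0: "\<And>x. \<epsilon> \<le> f x \<Longrightarrow> norm x \<le> R0"
    using compact_imp_bounded [OF compact_level [OF f \<epsilon>(1)]] by (auto simp: bounded_iff)
  define R where "R = \<bar>R0\<bar> + 1"
  have R: "0 < R" "{x. \<epsilon> \<le> f x} \<subseteq> cball 0 R" using R0 by (force simp: R_def)+
  define V where "V = measure lborel (cball (0::'a) (2 * R))"
  have V: "0 < V" "emeasure lborel (cball (0::'a) (2 * R)) = ennreal V"
    using R(1) by (simp_all add: V_def emeasure_compact_eq_measure)
  define \<beta> where "\<beta> = \<eta> / 2"
  have \<beta>: "0 < \<beta>" using \<eta> by (simp add: \<beta>_def)
  \<comment> \<open>Half of the average gain \<open>\<beta>\<^sup>2 / (M * V)\<close> that the estimates below provide.\<close>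
  define \<gamma> where "\<gamma> = \<beta>\<^sup>2 / (2 * M * V)"
  have \<gamma>: "0 < \<gamma>" using \<beta> M V by (simp add: \<gamma>_def)
  have "\<exists>u. norm u = 1 \<and> overlap h g + ennreal \<gamma> \<le> overlap (steiner_fun u h) g"
    if h: "h \<in> steiner_orbit f" and gap: "overlap h g + ennreal \<eta> \<le> ?I" for h
  proof (rule ccontr)
    assume neg: "\<not> ?thesis"
    have hc: "closed_log_concave h" by (rule steiner_orbit_closed_log_concave [OF h f])
    have hm [measurable]: "h \<in> borel_measurable borel" by (rule borel_measurable_closed_log_concave [OF hc])
    have h0: "\<And>x. 0 \<le> h x" by (rule closed_log_concave_nonneg [OF hc])
    have fin: "overlap h g < \<infinity>"
      using gap I by (auto simp: less_top [symmetric] top_unique)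
    define p where "p s = emeasure lborel {x. g x < s \<and> s \<le> h x}" for s
    have pm [measurable]: "p \<in> borel_measurable borel"
      unfolding p_def by (rule measurable_emeasure_slice) measurable
    have om [measurable]: "(\<lambda>s. emeasure lborel {x. s \<le> h x \<and> s \<le> g x}) \<in> borel_measurable borel"
      by (rule measurable_emeasure_slice) measurable
    have [measurable]: "(\<lambda>s. emeasure lborel {x. s \<le> min (f x) \<epsilon>}) \<in> borel_measurable borel"
      by (rule measurable_emeasure_slice) measurable
    have level_split: "emeasure lborel {x. s \<le> h x \<and> s \<le> g x} + p s = emeasure lborel {x. s \<le> f x}" if "0 < s" for s
    proof -
      have "emeasure lborel {x. s \<le> h x \<and> s \<le> g x} + p s
          = emeasure lborel ({x. s \<le> h x \<and> s \<le> g x} \<union> {x. g x < s \<and> s \<le> h x})"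
        unfolding p_def by (rule plus_emeasure) auto
      also have "{x. s \<le> h x \<and> s \<le> g x} \<union> {x. g x < s \<and> s \<le> h x} = {x. s \<le> h x}" by auto
      finally show ?thesis by (simp add: steiner_orbit_equimeasurable [OF h f that])
    qed
    have q: "emeasure lborel {x. h x < s \<and> s \<le> g x} = p s" if s: "0 < s" for s
    proof -
      have "emeasure lborel {x. s \<le> h x \<and> s \<le> g x} + emeasure lborel {x. h x < s \<and> s \<le> g x}
          = emeasure lborel ({x. s \<le> h x \<and> s \<le> g x} \<union> {x. h x < s \<and> s \<le> g x})"
        by (rule plus_emeasure) auto
      also have "{x. s \<le> h x \<and> s \<le> g x} \<union> {x. h x < s \<and> s \<le> g x} = {x. s \<le> g x}" by auto
      also have "emeasure lborel {x. s \<le> g x} = emeasure lborel {x. s \<le> h x \<and> s \<le> g x} + p s"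
        using level_split [OF s] symmetric_rearrangement_equimeasurable [OF f s] by (simp add: g_def)
      finally have eq: "emeasure lborel {x. s \<le> h x \<and> s \<le> g x} + emeasure lborel {x. h x < s \<and> s \<le> g x}
          = emeasure lborel {x. s \<le> h x \<and> s \<le> g x} + p s" .
      have "emeasure lborel {x. s \<le> h x \<and> s \<le> g x} \<le> emeasure lborel {x. s \<le> h x}"
        by (rule emeasure_mono) auto
      also have "\<dots> < \<infinity>" by (rule emeasure_compact_finite [OF compact_level [OF hc s]])
      finally show ?thesis using eq by (auto simp: ennreal_add_left_cancel)
    qed
    have "overlap h g + (\<integral>\<^sup>+s. indicator {0<..} s * p s \<partial>lborel)
        = (\<integral>\<^sup>+s. indicator {0<..} s * emeasure lborel {x. s \<le> h x \<and> s \<le> g x} + indicator {0<..} s * p s \<partial>lborel)"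
      unfolding overlap_layers [OF hm gm h0 g0] Collect_conj_eq [symmetric]
      by (rule nn_integral_add [symmetric]) measurable
    also have "\<dots> = (\<integral>\<^sup>+s. indicator {0<..} s * emeasure lborel {x. s \<le> f x} \<partial>lborel)"
      by (rule nn_integral_cong) (auto simp: level_split split: split_indicator)
    also have "\<dots> = ?I" by (rule layer_cake [symmetric]) (auto simp: f0)
    finally have deficit: "overlap h g + (\<integral>\<^sup>+s. indicator {0<..} s * p s \<partial>lborel) = ?I" .
    with gap have "overlap h g + ennreal \<eta> \<le> overlap h g + (\<integral>\<^sup>+s. indicator {0<..} s * p s \<partial>lborel)" by simp
    then have "ennreal \<eta> \<le> (\<integral>\<^sup>+s. indicator {0<..} s * p s \<partial>lborel)"
      using fin by (auto simp: ennreal_add_left_cancel_le)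
    also have "\<dots> \<le> (\<integral>\<^sup>+s. indicator {\<epsilon>..M} s * p s + indicator {0<..} s * emeasure lborel {x. s \<le> min (f x) \<epsilon>} \<partial>lborel)"
    proof (rule nn_integral_mono)
      fix s :: real
      \<comment> \<open>Levels below \<open>\<epsilon>\<close> are bounded by the truncated function, and above \<open>M\<close> there are none.\<close>
      consider "s \<le> 0" | "0 < s" "s < \<epsilon>" | "\<epsilon> \<le> s" "s \<le> M" | "M < s" by linarith
      then show "indicator {0<..} s * p s \<le> indicator {\<epsilon>..M} s * p s + indicator {0<..} s * emeasure lborel {x. s \<le> min (f x) \<epsilon>}"
      proof cases
        case 2
        have "p s \<le> emeasure lborel {x. s \<le> h x}"
          unfolding p_def by (rule emeasure_mono) auto
        also have "\<dots> = emeasure lborel {x. s \<le> min (f x) \<epsilon>}"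
          using 2 by (simp add: steiner_orbit_equimeasurable [OF h f])
        finally show ?thesis using 2 by simp
      next
        case 4
        have s: "0 < s" using 4 M by simp
        have "{x. s \<le> f x} = {}" using 4 M by (auto simp: not_le intro: less_trans)
        then have "emeasure lborel {x. s \<le> h x} = 0" by (simp add: steiner_orbit_equimeasurable [OF h f s])
        moreover have "p s \<le> emeasure lborel {x. s \<le> h x}"
          unfolding p_def by (rule emeasure_mono) auto
        ultimately show ?thesis by simp
      qed (use \<epsilon> in \<open>auto simp: add_increasing2\<close>)
    qed
    also have "\<dots> = (\<integral>\<^sup>+s. indicator {\<epsilon>..M} s * p s \<partial>lborel)
        + (\<integral>\<^sup>+s. indicator {0<..} s * emeasure lborel {x. s \<le> min (f x) \<epsilon>} \<partial>lborel)"
      by (rule nn_integral_add) measurable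
    also have "(\<integral>\<^sup>+s. indicator {0<..} s * emeasure lborel {x. s \<le> min (f x) \<epsilon>} \<partial>lborel)
        = (\<integral>\<^sup>+x. ennreal (min (f x) \<epsilon>) \<partial>lborel)"
      by (rule layer_cake [symmetric]) (use \<epsilon> f0 in auto)
    also have "\<dots> \<le> ennreal (\<eta> / 2)" using \<epsilon>(2) by simp
    finally have "ennreal \<eta> \<le> (\<integral>\<^sup>+s. indicator {\<epsilon>..M} s * p s \<partial>lborel) + ennreal (\<eta> / 2)"
      by (simp add: add_left_mono)
    moreover have "ennreal \<eta> = ennreal \<beta> + ennreal (\<eta> / 2)"
      using \<eta> by (simp add: \<beta>_def flip: ennreal_plus)
    ultimately have p\<beta>: "ennreal \<beta> \<le> (\<integral>\<^sup>+s. indicator {\<epsilon>..M} s * p s \<partial>lborel)"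
      by (auto simp: add.commute [of _ "ennreal (\<eta> / 2)"] ennreal_add_left_cancel_le)
    \<comment> \<open>The slope at which the tangent line bound is optimal, as \<open>\<beta> / M\<close> bounds the mean of \<open>p\<close> from below.\<close>
    define \<kappa> where "\<kappa> = \<beta> / M"
    have \<kappa>: "0 \<le> \<kappa>" using \<beta> M by (simp add: \<kappa>_def)
    have "ennreal (2 * \<kappa>) * ennreal \<beta> \<le> ennreal (2 * \<kappa>) * (\<integral>\<^sup>+s. indicator {\<epsilon>..M} s * p s \<partial>lborel)"
      by (rule mult_left_mono [OF p\<beta>]) simp
    also have "\<dots> = (\<integral>\<^sup>+s. ennreal (2 * \<kappa>) * (indicator {\<epsilon>..M} s * p s) \<partial>lborel)"
      by (rule nn_integral_cmult [symmetric]) measurable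
    also have "\<dots> \<le> (\<integral>\<^sup>+s. indicator {\<epsilon>..M} s * (p s * p s) + ennreal (\<kappa> * \<kappa>) * indicator {\<epsilon>..M} s \<partial>lborel)"
      by (rule nn_integral_mono) (use ennreal_square_tangent [OF \<kappa>] in \<open>auto split: split_indicator\<close>)
    also have "\<dots> = (\<integral>\<^sup>+s. indicator {\<epsilon>..M} s * (p s * p s) \<partial>lborel) + (\<integral>\<^sup>+s. ennreal (\<kappa> * \<kappa>) * indicator {\<epsilon>..M} s \<partial>lborel)"
      by (rule nn_integral_add) measurable
    also have "(\<integral>\<^sup>+s. ennreal (\<kappa> * \<kappa>) * indicator {\<epsilon>..M} s \<partial>lborel) = ennreal (\<kappa> * \<kappa>) * emeasure lborel {\<epsilon>..M}"
      by (rule nn_integral_cmult_indicator) simp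
    also have "\<dots> \<le> ennreal (\<kappa> * \<kappa>) * ennreal M"
      using \<epsilon> M by (intro mult_left_mono) (auto simp: emeasure_lborel_Icc_eq intro!: ennreal_leI)
    finally have lower: "ennreal (2 * \<kappa>) * ennreal \<beta>
        \<le> (\<integral>\<^sup>+s. indicator {\<epsilon>..M} s * (p s * p s) \<partial>lborel) + ennreal (\<kappa> * \<kappa>) * ennreal M"
      by (simp add: add_left_mono)
    \<comment> \<open>The gain that is guaranteed by symmetrizing in the direction of \<open>v\<close>.\<close>
    define G where "G v = (\<integral>\<^sup>+s. indicator {\<epsilon>..M} s * emeasure lborel
        {x. (g x < s \<and> s \<le> h x) \<and> (h (x + v) < s \<and> s \<le> g (x + v))} \<partial>lborel)" for v
    have G\<gamma>: "G v \<le> ennreal \<gamma> * indicator (cball 0 (2 * R)) v" for v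
    proof (cases "v = 0")
      case True
      have e: "{x. (g x < s \<and> s \<le> h x) \<and> (h (x + v) < s \<and> s \<le> g (x + v))} = {}" for s using True by auto
      show ?thesis unfolding G_def e by simp
    next
      case False
      show ?thesis
      proof (cases "v \<in> cball 0 (2 * R)")
        case True
        let ?u = "v /\<^sub>R norm v"
        have u: "norm ?u = 1" using False by simp
        have v: "v = norm v *\<^sub>R ?u" using False by simp
        have "overlap h g + G v \<le> overlap (steiner_fun ?u h) g"
          using overlap_steiner_gain [OF u hc g0 g \<epsilon>(1), of M "norm v"] unfolding G_def v [symmetric] by simp
        also have "\<dots> \<le> overlap h g + ennreal \<gamma>" using neg u by (meson le_cases)
        finally show ?thesis using True fin by (auto simp: ennreal_add_left_cancel_le)
      next
        case far: False
        have e: "indicator {\<epsilon>..M} s * emeasure lborel {x. (g x < s \<and> s \<le> h x) \<and> (h (x + v) < s \<and> s \<le> g (x + v))} = 0" for s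
        proof (cases "\<epsilon> \<le> s")
          case True
          then have s: "0 < s" using \<epsilon> by simp
          have fR: "{x. s \<le> f x} \<subseteq> cball 0 R" using R(2) True by auto
          have "{x. s \<le> h x} \<subseteq> cball 0 R" by (rule steiner_orbit_level_subset_cball [OF h f s fR])
          moreover have "{x. s \<le> g x} \<subseteq> cball 0 R"
            unfolding g [OF s] by (rule cball_volume_radius_subset [OF compact_level [OF f s] fR])
          ultimately have "norm v \<le> 2 * R" if "s \<le> h x" "s \<le> g (x + v)" for x
          proof -
            have "norm x \<le> R" "norm (x + v) \<le> R" using that \<open>{x. s \<le> h x} \<subseteq> _\<close> \<open>{x. s \<le> g x} \<subseteq> _\<close> by auto
            then show ?thesis using norm_triangle_ineq4 [of "x + v" x] by simp
          qed
          with far have no: "{x. (g x < s \<and> s \<le> h x) \<and> (h (x + v) < s \<and> s \<le> g (x + v))} = {}" by auto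
          show ?thesis unfolding no by simp
        qed simp
        show ?thesis unfolding G_def e by simp
      qed
    qed
    have "(\<integral>\<^sup>+s. indicator {\<epsilon>..M} s * (p s * p s) \<partial>lborel)
        = (\<integral>\<^sup>+s. indicator {\<epsilon>..M} s * (emeasure lborel {x. g x < s \<and> s \<le> h x} * emeasure lborel {x. h x < s \<and> s \<le> g x}) \<partial>lborel)"
      by (rule nn_integral_cong) (use \<epsilon> q in \<open>auto simp: p_def split: split_indicator\<close>)
    also have "\<dots> = (\<integral>\<^sup>+v. G v \<partial>lborel)"
      unfolding G_def by (rule integral_shifted_intersections [symmetric]) measurable
    also have "\<dots> \<le> (\<integral>\<^sup>+v. ennreal \<gamma> * indicator (cball (0::'a) (2 * R)) v \<partial>lborel)"
      by (rule nn_integral_mono) (rule G\<gamma>)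
    also have "\<dots> = ennreal \<gamma> * ennreal V"
      by (subst nn_integral_cmult_indicator) (simp_all add: V)
    finally have "ennreal (2 * \<kappa>) * ennreal \<beta> \<le> ennreal \<gamma> * ennreal V + ennreal (\<kappa> * \<kappa>) * ennreal M"
      by (rule order_trans [OF lower add_right_mono])
    then have "ennreal (2 * \<kappa> * \<beta>) \<le> ennreal (\<gamma> * V + \<kappa> * \<kappa> * M)"
      using \<kappa> \<beta> \<gamma> V M by (simp add: ennreal_mult ennreal_plus)
    then have "2 * \<kappa> * \<beta> \<le> \<gamma> * V + \<kappa> * \<kappa> * M"
      using \<kappa> \<beta> \<gamma> V M by (subst (asm) ennreal_le_iff) auto
    moreover have "\<gamma> * V = \<beta>\<^sup>2 / (2 * M)" "\<kappa> * \<kappa> * M = \<beta>\<^sup>2 / M" "2 * \<kappa> * \<beta> = 2 * (\<beta>\<^sup>2 / M)"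
      using V M by (simp_all add: \<gamma>_def \<kappa>_def power2_eq_square)
    moreover have "0 < \<beta>\<^sup>2 / M" using \<beta> M by simp
    ultimately show False by (simp add: field_simps)
  qed
  with \<gamma> that show ?thesis by blast
qed

text \<open>Otherwise the uniform gain could be repeated until the overlap exceeds the integral of
\<open>f\<close>.\<close>
lemma steiner_orbit_overlap_near_full:
  fixes f :: "'a::euclidean_space \<Rightarrow> real"
  assumes f: "closed_log_concave f" and \<eta>: "(0::real) < \<eta>"
  obtains h where "h \<in> steiner_orbit f"
    "(\<integral>\<^sup>+x. ennreal (f x) \<partial>lborel) < overlap h (symmetric_rearrangement f) + ennreal \<eta>"
proof (rule ccontr)
  let ?g = "symmetric_rearrangement f"
  let ?I = "\<integral>\<^sup>+x. ennreal (f x) \<partial>lborel"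
  assume neg: "\<not> thesis"
  note near = that
  have gap: "overlap h ?g + ennreal \<eta> \<le> ?I" if h: "h \<in> steiner_orbit f" for h
  proof (rule leI, rule notI)
    assume "?I < overlap h ?g + ennreal \<eta>"
    from near [OF h this] neg show False by contradiction
  qed
  obtain \<gamma> where \<gamma>: "0 < \<gamma>"
    "\<And>h. h \<in> steiner_orbit f \<Longrightarrow> overlap h ?g + ennreal \<eta> \<le> ?I
      \<Longrightarrow> \<exists>u. norm u = 1 \<and> overlap h ?g + ennreal \<gamma> \<le> overlap (steiner_fun u h) ?g"
    using steiner_orbit_uniform_gain [OF f \<eta>] by metis
  have large: "\<exists>h\<in>steiner_orbit f. ennreal (real k * \<gamma>) \<le> overlap h ?g" for k
  proof (induction k)
    case 0
    show ?case using steiner_orbit.start by auto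
  next
    case (Suc k)
    then obtain h where h: "h \<in> steiner_orbit f" "ennreal (real k * \<gamma>) \<le> overlap h ?g" by blast
    obtain u where u: "norm u = 1" "overlap h ?g + ennreal \<gamma> \<le> overlap (steiner_fun u h) ?g"
      using \<gamma>(2) [OF h(1) gap [OF h(1)]] by blast
    have "ennreal (real (Suc k) * \<gamma>) = ennreal (real k * \<gamma>) + ennreal \<gamma>"
      using \<gamma>(1) by (simp add: algebra_simps flip: ennreal_plus)
    also have "\<dots> \<le> overlap h ?g + ennreal \<gamma>" by (rule add_right_mono [OF h(2)])
    also note u(2)
    finally show ?case using steiner_orbit.step [OF h(1) u(1)] by blast
  qed
  obtain I where I: "?I = ennreal I" "0 \<le> I"
    using closed_log_concave_integral_finite [OF f] by (cases ?I) auto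
  obtain k where k: "I < real k * \<gamma>" using \<gamma>(1) reals_Archimedean3 by blast
  obtain h where h: "h \<in> steiner_orbit f" "ennreal (real k * \<gamma>) \<le> overlap h ?g" using large by blast
  have "overlap h ?g \<le> overlap h ?g + ennreal \<eta>" by simp
  also have "\<dots> \<le> ?I" by (rule gap [OF h(1)])
  finally have "overlap h ?g \<le> ?I" .
  then have "ennreal (real k * \<gamma>) \<le> ennreal I" using order_trans [OF h(2)] I(1) by simp
  then have "real k * \<gamma> \<le> I" by (simp add: ennreal_le_iff I(2))
  with k show False by simp
qed

lemma steiner_orbit_L1_approx:
  fixes f :: "'a::euclidean_space \<Rightarrow> real"
  assumes f: "closed_log_concave f"
  obtains h where "\<And>j. h j \<in> steiner_orbit f"
    "(\<lambda>j. \<integral>\<^sup>+x. ennreal \<bar>h j x - symmetric_rearrangement f x\<bar> \<partial>lborel) \<longlonglongrightarrow> 0"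
proof -
  let ?g = "symmetric_rearrangement f"
  let ?I = "\<integral>\<^sup>+x. ennreal (f x) \<partial>lborel"
  have I: "?I < \<infinity>" by (rule closed_log_concave_integral_finite [OF f])
  have "\<exists>h. h \<in> steiner_orbit f \<and> ?I < overlap h ?g + ennreal (1 / real (Suc j))" for j
    by (rule steiner_orbit_overlap_near_full [OF f, of "1 / real (Suc j)"]) auto
  then obtain h where h: "\<And>j. h j \<in> steiner_orbit f" "\<And>j. ?I < overlap (h j) ?g + ennreal (1 / real (Suc j))"
    by metis
  have le: "(\<integral>\<^sup>+x. ennreal \<bar>h j x - ?g x\<bar> \<partial>lborel) \<le> ennreal (2 / real (Suc j))" for j
  proof -
    let ?D = "\<integral>\<^sup>+x. ennreal \<bar>h j x - ?g x\<bar> \<partial>lborel"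
    have hc: "closed_log_concave (h j)" by (rule steiner_orbit_closed_log_concave [OF h(1) f])
    have [measurable]: "h j \<in> borel_measurable borel" "?g \<in> borel_measurable borel"
      by (auto intro: borel_measurable_closed_log_concave borel_measurable_symmetric_rearrangement f hc)
    have h0: "0 \<le> h j x" and g0: "0 \<le> ?g x" for x
      using closed_log_concave_nonneg [OF hc] symmetric_rearrangement_levels(1) [OF compact_level [OF f]] by auto
    have "?D + (overlap (h j) ?g + overlap (h j) ?g)
        = (\<integral>\<^sup>+x. ennreal \<bar>h j x - ?g x\<bar> + (ennreal (min (h j x) (?g x)) + ennreal (min (h j x) (?g x))) \<partial>lborel)"
      unfolding overlap_def by (subst nn_integral_add; (subst nn_integral_add)?) auto
    also have "\<dots> = (\<integral>\<^sup>+x. ennreal (h j x) + ennreal (?g x) \<partial>lborel)"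
      by (rule nn_integral_cong) (use h0 g0 in \<open>auto simp: min_def simp flip: ennreal_plus\<close>)
    also have "\<dots> = (\<integral>\<^sup>+x. ennreal (h j x) \<partial>lborel) + (\<integral>\<^sup>+x. ennreal (?g x) \<partial>lborel)"
      by (rule nn_integral_add) measurable
    also have "\<dots> = ?I + ?I"
      by (simp add: steiner_orbit_integral [OF h(1) f] symmetric_rearrangement_integral [OF f])
    finally have eq: "?D + (overlap (h j) ?g + overlap (h j) ?g) = ?I + ?I" .
    have o: "overlap (h j) ?g \<noteq> \<infinity>"
    proof
      assume "overlap (h j) ?g = \<infinity>"
      with eq have "?I + ?I = \<infinity>" by simp
      with I show False by simp
    qed
    have "?I + ?I \<le> (overlap (h j) ?g + ennreal (1 / real (Suc j))) + (overlap (h j) ?g + ennreal (1 / real (Suc j)))"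
      by (intro add_mono less_imp_le h(2))
    also have "\<dots> = (overlap (h j) ?g + overlap (h j) ?g) + ennreal (2 / real (Suc j))"
    proof -
      have "ennreal (2 / real (Suc j)) = ennreal (1 / real (Suc j)) + ennreal (1 / real (Suc j))"
        by (subst ennreal_plus [symmetric]) (auto simp: field_simps)
      then show ?thesis by (simp only: ac_simps)
    qed
    finally have "(overlap (h j) ?g + overlap (h j) ?g) + ?D \<le> (overlap (h j) ?g + overlap (h j) ?g) + ennreal (2 / real (Suc j))"
      using eq by (simp add: add.commute)
    then show ?thesis using o by (subst (asm) ennreal_add_left_cancel_le) auto
  qed
  have "(\<lambda>j. ennreal (2 / real (Suc j))) \<longlonglongrightarrow> ennreal 0"
    by (intro tendsto_ennrealI) real_asymp
  then have lim: "(\<lambda>j. ennreal (2 / real (Suc j))) \<longlonglongrightarrow> 0" by simp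
  have "(\<lambda>j. \<integral>\<^sup>+x. ennreal \<bar>h j x - ?g x\<bar> \<partial>lborel) \<longlonglongrightarrow> 0"
    by (rule tendsto_sandwich [OF always_eventually always_eventually tendsto_const lim]) (use le in simp_all)
  with h(1) that show ?thesis by blast
qed

section \<open>Log-concavity of the rearrangement\<close>

lemma emeasure_lborel_affine_image:
  fixes S :: "'a::euclidean_space set"
  assumes S: "S \<in> sets borel" and m: "m \<noteq> 0"
  shows "(\<lambda>x. d + m *\<^sub>R x) ` S \<in> sets borel"
    and "emeasure lborel ((\<lambda>x. d + m *\<^sub>R x) ` S) = ennreal (\<bar>m\<bar> ^ DIM('a)) * emeasure lborel S"
proof -
  have "(\<lambda>x. d + m *\<^sub>R x) ` S = (\<lambda>y. (1 / m) *\<^sub>R (y - d)) -` S \<inter> space borel"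
    using m by (auto simp: image_iff intro!: bexI [of _ "(1 / m) *\<^sub>R (_ - d)"])
  also have "\<dots> \<in> sets borel" by (rule measurable_sets [OF _ S]) measurable
  finally show im: "(\<lambda>x. d + m *\<^sub>R x) ` S \<in> sets borel" .
  have "emeasure lebesgue ((\<lambda>x. m *\<^sub>R x + d) ` S) = ennreal (\<bar>m\<bar> ^ DIM('a)) * emeasure lebesgue S"
    using emeasure_lebesgue_affine [of m d S] by (simp add: ennreal_power)
  with S im show "emeasure lborel ((\<lambda>x. d + m *\<^sub>R x) ` S) = ennreal (\<bar>m\<bar> ^ DIM('a)) * emeasure lborel S"
    by (simp add: add.commute)
qed

text \<open>Only the scaling of volume enters. This is the case of the Brunn--Minkowski inequality
in which one of the two summands is reduced to a point.\<close>
lemma volume_radius_scaled_subset: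
  fixes A C :: "'a::euclidean_space set"
  assumes A: "compact A" "A \<noteq> {}" and C: "compact C" and t: "0 < t"
    and sub: "\<And>w. w \<in> A \<Longrightarrow> d + t *\<^sub>R w \<in> C"
  shows "t * volume_radius A \<le> volume_radius C"
proof -
  have pos: "0 \<le> volume_radius A" "0 \<le> volume_radius C"
    using A sub by (auto simp: volume_radius_nonneg_iff)
  have "emeasure lborel (cball (0::'a) (t * volume_radius A)) = ennreal (t ^ DIM('a)) * emeasure lborel (cball (0::'a) (volume_radius A))"
    using pos t by (simp add: emeasure_cball power_mult_distrib mult_ac flip: ennreal_mult)
  also have "\<dots> = ennreal (\<bar>t\<bar> ^ DIM('a)) * emeasure lborel A"
    using t by (simp add: emeasure_cball_volume_radius [OF A(1)])
  also have "\<dots> = emeasure lborel ((\<lambda>w. d + t *\<^sub>R w) ` A)"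
    using A t by (intro emeasure_lborel_affine_image(2) [symmetric]) (auto simp: borel_compact)
  also have "\<dots> \<le> emeasure lborel C"
    using sub C by (intro emeasure_mono) (auto simp: borel_compact)
  also have "\<dots> = emeasure lborel (cball (0::'a) (volume_radius C))"
    by (simp add: emeasure_cball_volume_radius [OF C])
  finally show ?thesis using pos t by (simp add: emeasure_cball_le_iff)
qed

lemma open_not_subset_null:
  fixes U :: "'a::euclidean_space set"
  assumes "open U" "U \<noteq> {}" "N \<in> null_sets lborel"
  obtains x where "x \<in> U" "x \<notin> N"
proof -
  obtain a e where e: "0 < e" "ball a e \<subseteq> U"
    using assms(1,2) by (meson all_not_in_conv open_contains_ball)
  have "\<not> ball a e \<subseteq> N"
  proof
    assume "ball a e \<subseteq> N"
    then have "emeasure lborel (ball a e) \<le> emeasure lborel N"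
      using assms(3) by (intro emeasure_mono) auto
    moreover have "unit_ball_vol (real DIM('a)) \<noteq> 0"
      using unit_ball_vol_pos [of "real DIM('a)"] by linarith
    ultimately show False using e(1) assms(3) by (simp add: emeasure_ball null_sets_def)
  qed
  with e that show ?thesis by blast
qed

text \<open>With \<open>x\<close> chosen first, the points \<open>y\<close> that are then forbidden
form the union of \<open>N\<close> and of an affine image of \<open>N\<close>.\<close>
lemma generic_convex_combination:
  fixes U W :: "'a::euclidean_space set"
  assumes U: "open U" "U \<noteq> {}" and W: "open W" "W \<noteq> {}" and N: "N \<in> null_sets lborel" and t: "0 < t"
  obtains x y where "x \<in> U" "y \<in> W" "x \<notin> N" "y \<notin> N" "(1 - t) *\<^sub>R x + t *\<^sub>R y \<notin> N"
proof -
  obtain x where x: "x \<in> U" "x \<notin> N" using open_not_subset_null [OF U N] .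
  let ?T = "\<lambda>z. (- (1 - t) / t) *\<^sub>R x + (1 / t) *\<^sub>R z"
  have Nb: "N \<in> sets borel" "emeasure lborel N = 0" using N by (auto simp: null_sets_def)
  have "?T ` N \<in> null_sets lborel"
    using emeasure_lborel_affine_image [OF Nb(1), of "1 / t" "(- (1 - t) / t) *\<^sub>R x"] t Nb(2)
    by (auto simp: null_sets_def)
  then have "N \<union> ?T ` N \<in> null_sets lborel" using N by auto
  then obtain y where y: "y \<in> W" "y \<notin> N \<union> ?T ` N" using open_not_subset_null [OF W] by blast
  have "(1 - t) *\<^sub>R x + t *\<^sub>R y \<notin> N"
  proof
    assume "(1 - t) *\<^sub>R x + t *\<^sub>R y \<in> N"
    moreover have "y = ?T ((1 - t) *\<^sub>R x + t *\<^sub>R y)"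
      using t by (simp add: scaleR_add_right add_divide_distrib diff_divide_distrib flip: scaleR_left_distrib)
    ultimately show False using y(2) by blast
  qed
  with x y that show ?thesis by blast
qed

lemma AE_limit_of_L1_limit:
  fixes h :: "nat \<Rightarrow> 'a::euclidean_space \<Rightarrow> real"
  assumes h: "\<And>j. integrable lborel (h j)" and g: "integrable lborel g"
    and lim: "(\<lambda>j. \<integral>\<^sup>+x. ennreal \<bar>h j x - g x\<bar> \<partial>lborel) \<longlonglongrightarrow> 0"
  shows "\<exists>N\<in>null_sets lborel. \<exists>r. \<forall>x. x \<notin> N \<longrightarrow> (\<lambda>n. h (r n) x) \<longlonglongrightarrow> g x"
proof -
  have int: "integrable lborel (\<lambda>x. h j x - g x)" for j using h g by simp
  have "(\<integral>\<^sup>+x. ennreal \<bar>h j x - g x\<bar> \<partial>lborel) = ennreal (\<integral>x. norm (h j x - g x) \<partial>lborel)" for j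
    using nn_integral_eq_integral [OF integrable_norm [OF int [of j]]] by simp
  then have "(\<lambda>j. ennreal (\<integral>x. norm (h j x - g x) \<partial>lborel)) \<longlonglongrightarrow> ennreal 0" using lim by simp
  then have "(\<lambda>j. \<integral>x. norm (h j x - g x) \<partial>lborel) \<longlonglongrightarrow> 0"
    by (subst (asm) tendsto_ennreal_iff) auto
  from tendsto_L1_AE_subseq [OF int this]
  obtain r :: "nat \<Rightarrow> nat" where "AE x in lborel. (\<lambda>n. h (r n) x - g x) \<longlonglongrightarrow> 0" by blast
  then obtain N where N: "N \<in> null_sets lborel" "{x. \<not> (\<lambda>n. h (r n) x - g x) \<longlonglongrightarrow> 0} \<subseteq> N"
    by (auto simp: eventually_ae_filter)
  have "(\<lambda>n. h (r n) x) \<longlonglongrightarrow> g x" if "x \<notin> N" for x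
    by (rule LIM_zero_cancel) (use that N(2) in blast)
  with N(1) show ?thesis by blast
qed

lemma integrable_closed_log_concave:
  assumes "closed_log_concave f"
  shows "integrable lborel f"
  using assms closed_log_concave_integral_finite [OF assms]
  by (intro integrableI_nonneg) (auto simp: borel_measurable_closed_log_concave closed_log_concave_nonneg)

lemma integrable_symmetric_rearrangement:
  assumes "closed_log_concave f"
  shows "integrable lborel (symmetric_rearrangement f)"
  using assms closed_log_concave_integral_finite [OF assms]
  by (intro integrableI_nonneg)
    (auto simp: borel_measurable_symmetric_rearrangement symmetric_rearrangement_levels(1) compact_level
      symmetric_rearrangement_integral)

lemma limit_log_concave:
  fixes h :: "nat \<Rightarrow> 'a::euclidean_space \<Rightarrow> real"
  assumes h: "\<And>n. closed_log_concave (h n)" and t: "0 < t" "t < 1"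
    and x: "(\<lambda>n. h n x) \<longlonglongrightarrow> a" "0 < a" and y: "(\<lambda>n. h n y) \<longlonglongrightarrow> b" "0 < b"
    and z: "(\<lambda>n. h n ((1 - t) *\<^sub>R x + t *\<^sub>R y)) \<longlonglongrightarrow> c"
  shows "a powr (1 - t) * b powr t \<le> c"
proof (rule tendsto_le [OF _ z])
  show "(\<lambda>n. h n x powr (1 - t) * h n y powr t) \<longlonglongrightarrow> a powr (1 - t) * b powr t"
    using x y by (intro tendsto_intros) auto
  have "eventually (\<lambda>n. 0 < h n x) sequentially" "eventually (\<lambda>n. 0 < h n y) sequentially"
    using order_tendstoD(1) [OF x] order_tendstoD(1) [OF y] .
  then show "eventually (\<lambda>n. h n x powr (1 - t) * h n y powr t \<le> h n ((1 - t) *\<^sub>R x + t *\<^sub>R y)) sequentially"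
    by eventually_elim (rule closed_log_concave_levels [OF h t], auto)
qed simp

text \<open>For the radii of the level sets this is the Brunn--Minkowski inequality. It is obtained
from the convergence of iterated symmetrals: these are log-concave, a subsequence converges almost
everywhere, and log-concavity passes to the limit at points \<open>x'\<close>, \<open>y'\<close>
chosen generically near \<open>x\<close> and \<open>y\<close>. To ensure that the limit is still at
least \<open>s\<close> and \<open>r\<close> there, the points are taken inside the level balls,
which requires positive radii. A ball of radius zero is treated by scaling alone.\<close>
lemma symmetric_rearrangement_log_concave:
  fixes f :: "'a::euclidean_space \<Rightarrow> real"
  assumes f: "closed_log_concave f" and t: "0 < t" "t < 1"
    and s: "0 < s" "s \<le> symmetric_rearrangement f x" and r: "0 < r" "r \<le> symmetric_rearrangement f y"
  shows "s powr (1 - t) * r powr t \<le> symmetric_rearrangement f ((1 - t) *\<^sub>R x + t *\<^sub>R y)"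
proof -
  let ?g = "symmetric_rearrangement f"
  let ?\<rho> = "\<lambda>s. volume_radius {z. s \<le> f z}"
  let ?z = "(1 - t) *\<^sub>R x + t *\<^sub>R y"
  define q where "q = s powr (1 - t) * r powr t"
  have q: "0 < q" using s r by (simp add: q_def)
  have lev: "k \<le> ?g w \<longleftrightarrow> norm w \<le> ?\<rho> k" if "0 < k" for k w
    using symmetric_rearrangement_levels(2) [OF compact_level [OF f] that] by (auto simp: set_eq_iff)
  have xs: "norm x \<le> ?\<rho> s" and yr: "norm y \<le> ?\<rho> r" using s r lev by auto
  then have "0 \<le> ?\<rho> s" "0 \<le> ?\<rho> r" using norm_ge_zero order_trans by blast+
  then have ne: "{z. s \<le> f z} \<noteq> {}" "{z. r \<le> f z} \<noteq> {}" by (auto simp only: volume_radius_nonneg_iff)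
  have comb: "q \<le> f ((1 - t) *\<^sub>R v + t *\<^sub>R w)" if "s \<le> f v" "r \<le> f w" for v w
    unfolding q_def by (rule closed_log_concave_levels [OF f t s(1) r(1) that])
  have nz: "norm ?z \<le> (1 - t) * norm x + t * norm y"
    using norm_triangle_ineq [of "(1 - t) *\<^sub>R x" "t *\<^sub>R y"] t by simp
  have "norm ?z \<le> ?\<rho> q"
  proof -
    consider "?\<rho> s = 0" | "?\<rho> r = 0" | "0 < ?\<rho> s" "0 < ?\<rho> r"
      using \<open>0 \<le> ?\<rho> s\<close> \<open>0 \<le> ?\<rho> r\<close> by linarith
    then show ?thesis
    proof cases
      case 1
      obtain p where "s \<le> f p" using ne(1) by blast
      then have "t * ?\<rho> r \<le> ?\<rho> q"
        using comb ne(2) t by (intro volume_radius_scaled_subset [where d = "(1 - t) *\<^sub>R p"] compact_level f q r) auto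
      moreover have "norm ?z \<le> t * norm y" using nz xs 1 by simp
      moreover have "t * norm y \<le> t * ?\<rho> r" using yr t by simp
      ultimately show ?thesis by linarith
    next
      case 2
      obtain p where "r \<le> f p" using ne(2) by blast
      then have "(1 - t) * ?\<rho> s \<le> ?\<rho> q"
        using comb ne(1) t
        by (intro volume_radius_scaled_subset [where d = "t *\<^sub>R p"] compact_level f q s) (auto simp: add.commute)
      moreover have "norm ?z \<le> (1 - t) * norm x" using nz yr 2 by simp
      moreover have "(1 - t) * norm x \<le> (1 - t) * ?\<rho> s" using xs t by simp
      ultimately show ?thesis by linarith
    next
      case 3
      show ?thesis
      proof (rule ccontr)
        assume "\<not> norm ?z \<le> ?\<rho> q"
        then have e: "0 < norm ?z - ?\<rho> q" (is "0 < ?e") by simp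
        obtain h where h: "\<And>j. h j \<in> steiner_orbit f"
            "(\<lambda>j. \<integral>\<^sup>+x. ennreal \<bar>h j x - ?g x\<bar> \<partial>lborel) \<longlonglongrightarrow> 0"
          using steiner_orbit_L1_approx [OF f] by blast
        have hc: "closed_log_concave (h j)" for j by (rule steiner_orbit_closed_log_concave [OF h(1) f])
        have "\<exists>N\<in>null_sets lborel. \<exists>r. \<forall>x. x \<notin> N \<longrightarrow> (\<lambda>n. h (r n) x) \<longlonglongrightarrow> ?g x"
          by (rule AE_limit_of_L1_limit [OF integrable_closed_log_concave [OF hc] integrable_symmetric_rearrangement [OF f] h(2)])
        then obtain N m where N: "N \<in> null_sets lborel" "\<And>x. x \<notin> N \<Longrightarrow> (\<lambda>n. h (m n) x) \<longlonglongrightarrow> ?g x"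
          by blast
        have near: "ball (0::'a) R \<inter> ball w ?e \<noteq> {}" if "0 < R" "norm w \<le> R" for w R
        proof -
          have "w \<in> closure (ball 0 R)" using that by simp
          moreover have "w \<in> ball w ?e" using e by simp
          ultimately have "ball w ?e \<inter> closure (ball 0 R) \<noteq> {}" by blast
          then show ?thesis using open_Int_closure_eq_empty [OF open_ball, of w ?e "ball 0 R"] by blast
        qed
        obtain x' y' where xy: "x' \<in> ball 0 (?\<rho> s) \<inter> ball x ?e" "y' \<in> ball 0 (?\<rho> r) \<inter> ball y ?e"
            "x' \<notin> N" "y' \<notin> N" "(1 - t) *\<^sub>R x' + t *\<^sub>R y' \<notin> N"
          using generic_convex_combination [OF open_Int [OF open_ball open_ball] near [OF 3(1) xs]
              open_Int [OF open_ball open_ball] near [OF 3(2) yr] N(1) t(1)] by blast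
        let ?z' = "(1 - t) *\<^sub>R x' + t *\<^sub>R y'"
        have gx: "s \<le> ?g x'" "r \<le> ?g y'" using xy s r by (auto simp: lev)
        have "?g x' powr (1 - t) * ?g y' powr t \<le> ?g ?z'"
          using gx s r by (intro limit_log_concave [OF hc t N(2) _ N(2) _ N(2)] xy) simp_all
        moreover have "q \<le> ?g x' powr (1 - t) * ?g y' powr t"
          unfolding q_def using gx s r t by (intro powr_convex_comb_mono) auto
        ultimately have "norm ?z' \<le> ?\<rho> q" unfolding lev [OF q, symmetric] by (rule order_trans [rotated])
        moreover have "norm (?z - ?z') < ?e"
        proof -
          have "?z - ?z' = (1 - t) *\<^sub>R (x - x') + t *\<^sub>R (y - y')" by (simp add: algebra_simps)
          then have "norm (?z - ?z') \<le> (1 - t) * norm (x - x') + t * norm (y - y')"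
            using norm_triangle_ineq [of "(1 - t) *\<^sub>R (x - x')" "t *\<^sub>R (y - y')"] t by simp
          also have "\<dots> < ?e"
            using t xy by (intro convex_bound_lt) (auto simp: dist_norm)
          finally show ?thesis .
        qed
        moreover have "norm ?z \<le> norm ?z' + norm (?z - ?z')" by (metis add.commute norm_triangle_sub)
        ultimately show False by linarith
      qed
    qed
  qed
  then show ?thesis using lev [OF q] by (simp add: q_def)
qed

lemma closed_log_concave_symmetric_rearrangement:
  fixes f :: "'a::euclidean_space \<Rightarrow> real"
  assumes f: "closed_log_concave f"
  shows "closed_log_concave (symmetric_rearrangement f)"
proof -
  let ?g = "symmetric_rearrangement f"
  have lev: "{x. s \<le> ?g x} = cball 0 (volume_radius {x. s \<le> f x})" if "0 < s" for s
    by (rule symmetric_rearrangement_levels(2) [OF compact_level [OF f] that])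
  have f0: "0 < f 0" using f by (simp add: closed_log_concave_def)
  have "0 \<le> volume_radius {x. f 0 \<le> f x}" by (auto simp: volume_radius_nonneg_iff)
  then have "f 0 \<le> ?g 0" using lev [OF f0] by (auto simp: set_eq_iff)
  then have "0 < ?g 0" using f0 by simp
  moreover have "\<exists>s>0. 0 < emeasure lborel {x. s \<le> ?g x}"
  proof -
    obtain s where "0 < s" "0 < emeasure lborel {x. s \<le> f x}"
      using f by (auto simp: closed_log_concave_def)
    then show ?thesis using symmetric_rearrangement_equimeasurable [OF f] by (intro exI [of _ s]) simp
  qed
  moreover have "0 \<le> ?g x" for x by (rule symmetric_rearrangement_levels(1) [OF compact_level [OF f]])
  ultimately show ?thesis
    unfolding closed_log_concave_def
    using lev symmetric_rearrangement_log_concave [OF f] by auto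
qed

section \<open>Log-concave functions as exponentials of convex functions\<close>

lemma exp_neg_ge_iff:
  assumes "0 < s" "v \<noteq> - \<infinity>"
  shows "s \<le> exp_neg v \<longleftrightarrow> v \<le> ereal (- ln s)"
proof (cases v)
  case (real a)
  have "s \<le> exp (- a) \<longleftrightarrow> ln s \<le> - a"
    using assms(1) ln_le_cancel_iff [of s "exp (- a)"] by simp
  then show ?thesis using real by (auto simp: exp_neg_def)
qed (use assms in \<open>auto simp: exp_neg_def\<close>)

text \<open>A convex effective domain that lies in no hyperplane has interior points, and it is the
union of countably many superlevel sets, so one of these has positive volume.\<close>
lemma closed_log_concave_exp_neg:
  fixes \<psi> :: "real^'n \<Rightarrow> ereal"
  assumes "\<psi> \<in> Conv_c"
  shows "closed_log_concave (\<lambda>x. exp_neg (\<psi> x))"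
proof -
  have \<psi>: "\<And>x. \<psi> x \<noteq> -\<infinity>" and cvx: "ereal_convex \<psi>" and coer: "(\<psi> \<longlongrightarrow> \<infinity>) at_infinity"
    and epi: "closed (ereal_epigraph \<psi>)" and dom0: "0 \<in> eff_dom \<psi>"
    and hyp: "\<not> (\<exists>a b. a \<noteq> 0 \<and> eff_dom \<psi> \<subseteq> {x. a \<bullet> x = b})"
    using assms by (auto simp: Conv_c_def)
  let ?f = "\<lambda>x. exp_neg (\<psi> x)"
  have f_pos: "0 < ?f x \<longleftrightarrow> \<psi> x < \<infinity>" for x by (auto simp: exp_neg_def)
  have lev: "{x. s \<le> ?f x} = {x. \<psi> x \<le> ereal (- ln s)}" if "0 < s" for s
    using that \<psi> by (simp add: exp_neg_ge_iff)
  have cpt: "compact {x. s \<le> ?f x}" if s: "0 < s" for s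
  proof -
    have "{x. s \<le> ?f x} = (\<lambda>x. (x, - ln s)) -` ereal_epigraph \<psi>"
      by (auto simp: lev [OF s] ereal_epigraph_def)
    moreover have "closed ((\<lambda>x. (x, - ln s)) -` ereal_epigraph \<psi>)"
      by (intro continuous_closed_vimage epi continuous_intros)
    moreover have "eventually (\<lambda>x. ereal (- ln s) < \<psi> x) at_infinity"
      using coer by (simp add: tendsto_PInfty)
    then obtain b where b: "\<And>x. b \<le> norm x \<Longrightarrow> ereal (- ln s) < \<psi> x"
      by (auto simp: eventually_at_infinity)
    have "bounded {x. s \<le> ?f x}"
      unfolding bounded_iff lev [OF s] using b by (intro exI [of _ b]) (meson le_cases linorder_not_less mem_Collect_eq ballI)
    ultimately show ?thesis by (simp add: compact_eq_bounded_closed)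
  qed
  have conc: "?f x powr (1 - t) * ?f y powr t \<le> ?f ((1 - t) *\<^sub>R x + t *\<^sub>R y)"
    if t: "0 < t" "t < 1" and xy: "0 < ?f x" "0 < ?f y" for x y t
  proof -
    let ?z = "(1 - t) *\<^sub>R x + t *\<^sub>R y"
    obtain a where a: "\<psi> x = ereal a" using xy(1) \<psi> [of x] unfolding f_pos by (cases "\<psi> x") auto
    obtain b where b: "\<psi> y = ereal b" using xy(2) \<psi> [of y] unfolding f_pos by (cases "\<psi> y") auto
    have z: "\<psi> ?z \<le> ereal ((1 - t) * a + t * b)"
      using cvx t unfolding ereal_convex_def by (metis a b plus_ereal.simps(1) times_ereal.simps(1))
    then obtain c where c: "\<psi> ?z = ereal c" using \<psi> [of ?z] by (cases "\<psi> ?z") auto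
    have "exp (- ((1 - t) * a + t * b)) \<le> exp (- c)" using z c by simp
    then show ?thesis using a b c
      by (simp add: exp_neg_def powr_def algebra_simps flip: exp_add)
  qed
  have dom_convex: "convex (eff_dom \<psi>)"
    unfolding convex_alt
  proof (intro ballI allI impI, elim conjE)
    fix x y and t :: real assume *: "x \<in> eff_dom \<psi>" "y \<in> eff_dom \<psi>" "0 \<le> t" "t \<le> 1"
    show "(1 - t) *\<^sub>R x + t *\<^sub>R y \<in> eff_dom \<psi>"
    proof (cases "t = 0 \<or> t = 1")
      case False
      have xy: "0 < ?f x" "0 < ?f y" unfolding f_pos using * by (simp_all add: eff_dom_def)
      then have "0 < ?f x powr (1 - t) * ?f y powr t" by simp
      also have "\<dots> \<le> ?f ((1 - t) *\<^sub>R x + t *\<^sub>R y)"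
        using xy * False by (intro conc) auto
      finally show ?thesis by (simp add: f_pos eff_dom_def)
    qed (use * in auto)
  qed
  have "\<exists>s>0. 0 < emeasure lborel {x. s \<le> ?f x}"
  proof (rule ccontr)
    assume "\<not> ?thesis"
    then have null: "{x. 1 / real (Suc n) \<le> ?f x} \<in> null_sets lborel" for n
      using cpt [of "1 / real (Suc n)"] by (auto simp: null_sets_def borel_compact zero_less_iff_neq_zero)
    have "eff_dom \<psi> \<subseteq> (\<Union>n. {x. 1 / real (Suc n) \<le> ?f x})"
    proof
      fix x assume "x \<in> eff_dom \<psi>"
      then have "0 < ?f x" by (simp add: f_pos eff_dom_def)
      then obtain n where "1 / real (Suc n) < ?f x" using nat_approx_posE by metis
      then show "x \<in> (\<Union>n. {x. 1 / real (Suc n) \<le> ?f x})" by (auto intro: less_imp_le)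
    qed
    moreover have "(\<Union>n. {x. 1 / real (Suc n) \<le> ?f x}) \<in> null_sets lborel" by (intro null_sets_UN null)
    ultimately have "interior (eff_dom \<psi>) = {}"
      using open_not_subset_null [OF open_interior, of "eff_dom \<psi>"] interior_subset by (metis subset_iff)
    then show False using empty_interior_subset_hyperplane [OF dom_convex] hyp by metis
  qed
  moreover have "0 < ?f 0" using dom0 by (simp add: f_pos eff_dom_def)
  moreover have "0 \<le> ?f x" for x by (simp add: exp_neg_def)
  ultimately show ?thesis
    unfolding closed_log_concave_def using cpt conc by blast
qed

text \<open>The convex function is \<open>- ln f\<close>. Its epigraph is closed because it can be
written as the intersection over all real \<open>c\<close> of the sets of pairs \<open>(x,
r)\<close> with \<open>c \<le> r\<close> or \<open>\<psi> x \<le> c\<close>.\<close>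
lemma closed_log_concave_imp_LC_c:
  fixes f :: "real^'n \<Rightarrow> real"
  assumes f: "closed_log_concave f"
  shows "f \<in> LC_c"
proof -
  have f0: "0 \<le> f x" for x by (rule closed_log_concave_nonneg [OF f])
  define \<psi> where "\<psi> x = (if f x = 0 then \<infinity> else ereal (- ln (f x)))" for x
  have \<psi>: "\<psi> x \<noteq> - \<infinity>" for x by (simp add: \<psi>_def)
  have f_eq: "f x = exp_neg (\<psi> x)" for x
    using f0 [of x] by (simp add: \<psi>_def exp_neg_def)
  have lev: "{x. \<psi> x \<le> ereal r} = {x. exp (- r) \<le> f x}" for r
    using exp_neg_ge_iff [of "exp (- r)"] \<psi> by (simp add: f_eq)
  have dom: "eff_dom \<psi> = {x. 0 < f x}"
    using f0 by (auto simp: eff_dom_def \<psi>_def order.order_iff_strict)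
  have "ereal_convex \<psi>"
    unfolding ereal_convex_def
  proof (intro allI impI, elim conjE)
    fix x y :: "real^'n" and t :: real assume t: "0 < t" "t < 1"
    let ?z = "(1 - t) *\<^sub>R x + t *\<^sub>R y"
    show "\<psi> ?z \<le> ereal (1 - t) * \<psi> x + ereal t * \<psi> y"
    proof (cases "f x = 0 \<or> f y = 0")
      case True
      then have "ereal (1 - t) * \<psi> x + ereal t * \<psi> y = \<infinity>" using t by (auto simp: \<psi>_def)
      then show ?thesis by (simp only: ereal_less_eq)
    next
      case False
      then have xy: "0 < f x" "0 < f y" using f0 [of x] f0 [of y] by auto
      then have prod: "0 < f x powr (1 - t) * f y powr t" by simp
      have le: "f x powr (1 - t) * f y powr t \<le> f ?z"
        using f t xy unfolding closed_log_concave_def by blast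
      then have z: "0 < f ?z" using prod by linarith
      have "ln (f x powr (1 - t) * f y powr t) \<le> ln (f ?z)"
        using le prod z by (subst ln_le_cancel_iff)
      then have "(1 - t) * ln (f x) + t * ln (f y) \<le> ln (f ?z)"
        using xy by (simp add: ln_mult ln_powr)
      then show ?thesis using xy z by (simp add: \<psi>_def)
    qed
  qed
  moreover have "(\<psi> \<longlongrightarrow> \<infinity>) at_infinity"
    unfolding tendsto_PInfty
  proof
    fix r
    have "bounded {x. \<psi> x \<le> ereal r}"
      unfolding lev by (intro compact_imp_bounded compact_level [OF f]) simp
    then obtain B where B: "\<And>x. \<psi> x \<le> ereal r \<Longrightarrow> norm x \<le> B" by (auto simp: bounded_iff)
    have "ereal r < \<psi> x" if "B + 1 \<le> norm x" for x
    proof (rule ccontr)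
      assume "\<not> ereal r < \<psi> x"
      then have "norm x \<le> B" by (intro B) (simp add: not_less)
      with that show False by simp
    qed
    then show "eventually (\<lambda>x. ereal r < \<psi> x) at_infinity"
      unfolding eventually_at_infinity by blast
  qed
  moreover have "closed (ereal_epigraph \<psi>)"
  proof -
    have "ereal_epigraph \<psi> = (\<Inter>c. {p. c \<le> snd p} \<union> {x. \<psi> x \<le> ereal c} \<times> UNIV)"
    proof (intro set_eqI iffI)
      fix p assume "p \<in> ereal_epigraph \<psi>"
      then have p: "\<psi> (fst p) \<le> ereal (snd p)" by (auto simp: ereal_epigraph_def)
      have "c \<le> snd p \<or> \<psi> (fst p) \<le> ereal c" for c
        using order_trans [OF p, of "ereal c"] by (cases "c \<le> snd p") simp_all
      then show "p \<in> (\<Inter>c. {p. c \<le> snd p} \<union> {x. \<psi> x \<le> ereal c} \<times> UNIV)"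
        by (simp add: mem_Times_iff)
    next
      fix p assume p: "p \<in> (\<Inter>c. {p. c \<le> snd p} \<union> {x. \<psi> x \<le> ereal c} \<times> UNIV)"
      have "\<psi> (fst p) \<le> ereal (snd p)"
      proof (rule ereal_le_epsilon2)
        fix e :: real assume "0 < e"
        moreover have "p \<in> {p. snd p + e \<le> snd p} \<union> {x. \<psi> x \<le> ereal (snd p + e)} \<times> UNIV" using p by blast
        ultimately show "\<psi> (fst p) \<le> ereal (snd p) + ereal e" by (auto simp: mem_Times_iff)
      qed
      then show "p \<in> ereal_epigraph \<psi>" by (cases p) (simp add: ereal_epigraph_def)
    qed
    moreover have "closed \<dots>"
    proof (intro closed_INT ballI closed_Un closed_Times closed_UNIV)
      show "closed {p :: (real^'n) \<times> real. c \<le> snd p}" for c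
        by (intro closed_Collect_le continuous_intros)
      show "closed {x. \<psi> x \<le> ereal c}" for c
        unfolding lev by (intro compact_imp_closed compact_level [OF f]) simp
    qed
    ultimately show ?thesis by simp
  qed
  moreover have "0 < f 0" using f by (simp add: closed_log_concave_def)
  then have "0 \<in> eff_dom \<psi>" by (simp add: dom)
  moreover then have "\<exists>x. \<psi> x \<noteq> \<infinity>" by (auto simp: eff_dom_def)
  moreover have "\<not> (\<exists>a b. a \<noteq> 0 \<and> eff_dom \<psi> \<subseteq> {x. a \<bullet> x = b})"
  proof
    assume "\<exists>a b. a \<noteq> 0 \<and> eff_dom \<psi> \<subseteq> {x. a \<bullet> x = b}"
    then obtain a b where ab: "a \<noteq> 0" "eff_dom \<psi> \<subseteq> {x. a \<bullet> x = b}" by blast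
    obtain s where s: "0 < s" "0 < emeasure lborel {x. s \<le> f x}" using f by (auto simp: closed_log_concave_def)
    have "{x. s \<le> f x} \<subseteq> {x. a \<bullet> x = b}" using ab(2) s(1) unfolding dom by (auto dest: less_le_trans)
    then have "negligible {x. s \<le> f x}"
      using negligible_hyperplane [of a b] ab(1) negligible_subset by blast
    moreover have "{x. s \<le> f x} \<in> sets borel" by (intro borel_compact compact_level [OF f s(1)])
    ultimately have "emeasure lborel {x. s \<le> f x} = 0"
      by (auto simp: negligible_iff_null_sets null_sets_def)
    with s(2) show False by simp
  qed
  ultimately have "\<psi> \<in> Conv_c" using \<psi> by (simp add: Conv_c_def)
  then show ?thesis using f_eq by (auto simp: LC_c_def)
qed

lemma LC_c_iff: "f \<in> LC_c \<longleftrightarrow> closed_log_concave f"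
  using closed_log_concave_exp_neg closed_log_concave_imp_LC_c by (auto simp: LC_c_def)

section \<open>Steiner symmetrals and rearrangements as uniquely determined functions\<close>

lemma hyperplane_in_Gr_hyp:
  fixes u :: "real^'n"
  assumes "norm u = 1"
  shows "{u}\<^sup>\<bottom> \<in> Gr_hyp"
proof -
  have "u \<noteq> 0" using assms by auto
  then have "dim {x. u \<bullet> x = 0} = CARD('n) - 1" by (simp add: dim_hyperplane)
  moreover have "{u}\<^sup>\<bottom> = {x. u \<bullet> x = 0}" by (simp add: orthogonal_comp_def orthogonal_def)
  ultimately show ?thesis by (simp add: Gr_hyp_def subspace_hyperplane)
qed

lemma unit_normal_unique:
  fixes u v :: "'a::euclidean_space"
  assumes "norm u = 1" "norm v = 1" "{u}\<^sup>\<bottom> = {v}\<^sup>\<bottom>"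
  shows "v = u \<or> v = - u"
proof -
  let ?c = "v \<bullet> u"
  have uu: "u \<bullet> u = 1" "v \<bullet> v = 1" using assms by (simp_all add: norm_eq_1)
  have "v - ?c *\<^sub>R u \<in> {u}\<^sup>\<bottom>"
    by (simp add: orthogonal_comp_def orthogonal_def inner_diff_right uu inner_commute)
  then have "v - ?c *\<^sub>R u \<in> {v}\<^sup>\<bottom>" using assms(3) by simp
  then have c: "?c * ?c = 1"
    by (simp add: orthogonal_comp_def orthogonal_def inner_diff_right uu)
  have "(v - ?c *\<^sub>R u) \<bullet> (v - ?c *\<^sub>R u) = 1 - ?c * ?c"
    by (simp add: inner_diff_left inner_diff_right uu inner_commute)
  then have "v = ?c *\<^sub>R u" using c by simp
  moreover have "?c = 1 \<or> ?c = - 1" using c by (simp add: square_eq_1_iff)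
  ultimately show ?thesis by auto
qed

lemma steiner_fun_uminus: "steiner_fun (- u) f = steiner_fun u f"
proof -
  have "steiner_set (- u) A = steiner_set u A" for A
  proof -
    have "(\<exists>c. x + c *\<^sub>R (- u) \<in> A \<and> z + c *\<^sub>R (- u) \<in> A) \<longleftrightarrow> (\<exists>c. x + c *\<^sub>R u \<in> A \<and> z + c *\<^sub>R u \<in> A)" for x z
    proof
      assume "\<exists>c. x + c *\<^sub>R (- u) \<in> A \<and> z + c *\<^sub>R (- u) \<in> A"
      then obtain c where "x + c *\<^sub>R (- u) \<in> A \<and> z + c *\<^sub>R (- u) \<in> A" ..
      then show "\<exists>c. x + c *\<^sub>R u \<in> A \<and> z + c *\<^sub>R u \<in> A" by (intro exI [of _ "- c"]) simp
    next
      assume "\<exists>c. x + c *\<^sub>R u \<in> A \<and> z + c *\<^sub>R u \<in> A"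
      then obtain c where "x + c *\<^sub>R u \<in> A \<and> z + c *\<^sub>R u \<in> A" ..
      then show "\<exists>c. x + c *\<^sub>R (- u) \<in> A \<and> z + c *\<^sub>R (- u) \<in> A" by (intro exI [of _ "- c"]) simp
    qed
    then show ?thesis by (simp add: steiner_set_def reflect_def)
  qed
  then show ?thesis by (simp add: steiner_fun_def)
qed

text \<open>The levels of \<open>f\<close> on a line form a compact interval, whose supremum and
infimum are its end points.\<close>
lemma hypograph_steiner_fun:
  fixes f :: "real^'n \<Rightarrow> real"
  assumes u: "norm u = 1" and f: "closed_log_concave f"
  shows "hypograph (steiner_fun u f) = steiner_region u f"
proof -
  have uu: "u \<bullet> u = 1" using u by (simp add: norm_eq_1)
  have perp: "y \<in> {u}\<^sup>\<bottom> \<longleftrightarrow> y \<bullet> u = 0" for y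
    by (simp add: orthogonal_comp_def orthogonal_def inner_commute)
  have key: "y + t *\<^sub>R u \<in> steiner_set u {z. s \<le> f z} \<longleftrightarrow> line_level f u y s \<noteq> {}
      \<and> \<bar>t\<bar> \<le> (1/2) * (Sup (line_level f u y s) - Inf (line_level f u y s))"
    if y: "y \<bullet> u = 0" and s: "0 < s" for y t s
  proof -
    have L: "line_level f u y s = {t. y + t *\<^sub>R u \<in> {z. s \<le> f z}}" by (simp add: line_level_def)
    show ?thesis
    proof (rule steiner_set_line_cases [OF u compact_level [OF f s] convex_level [OF f s], of y])
      fix a b assume ab: "a \<le> b" "{t. y + t *\<^sub>R u \<in> {z. s \<le> f z}} = {a..b}"
        and S: "{t. y + t *\<^sub>R u \<in> steiner_set u {z. s \<le> f z}} = {t. \<bar>t + y \<bullet> u\<bar> \<le> (b - a) / 2}"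
      have "y + t *\<^sub>R u \<in> steiner_set u {z. s \<le> f z} \<longleftrightarrow> \<bar>t\<bar> \<le> (b - a) / 2"
        using S y by (auto simp: set_eq_iff)
      then show ?thesis unfolding L ab(2) using ab(1) by simp
    next
      assume "{t. y + t *\<^sub>R u \<in> {z. s \<le> f z}} = {}" "{t. y + t *\<^sub>R u \<in> steiner_set u {z. s \<le> f z}} = {}"
      then show ?thesis unfolding L by blast
    qed
  qed
  have lev: "s \<le> steiner_fun u f x \<longleftrightarrow> x \<in> steiner_set u {z. s \<le> f z}" if "0 < s" for s x
    using steiner_fun_levels(2) [OF u compact_level [OF f] that] by auto
  show ?thesis
  proof (intro set_eqI iffI)
    fix p assume "p \<in> hypograph (steiner_fun u f)"
    then obtain x s where p: "p = (x, s)" "0 < s" "x \<in> steiner_set u {z. s \<le> f z}"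
      by (auto simp: hypograph_def lev)
    let ?y = "x - (x \<bullet> u) *\<^sub>R u"
    have y: "?y \<bullet> u = 0" by (simp add: inner_diff_left uu)
    have x: "x = ?y + (x \<bullet> u) *\<^sub>R u" by simp
    have "line_level f u ?y s \<noteq> {}
        \<and> \<bar>x \<bullet> u\<bar> \<le> (1/2) * (Sup (line_level f u ?y s) - Inf (line_level f u ?y s))"
      using key [OF y p(2), of "x \<bullet> u"] p(3) x by simp
    then show "p \<in> steiner_region u f"
      unfolding steiner_region_def mem_Collect_eq perp
      using p y by (intro exI [of _ ?y] exI [of _ "x \<bullet> u"] exI [of _ s]) simp
  next
    fix p assume "p \<in> steiner_region u f"
    then show "p \<in> hypograph (steiner_fun u f)"
      unfolding steiner_region_def mem_Collect_eq perp
      by (auto simp: hypograph_def lev key)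
  qed
qed

lemma hypograph_eqD:
  fixes g h :: "real^'n \<Rightarrow> real"
  assumes "\<And>x. 0 \<le> g x" "\<And>x. 0 \<le> h x" "hypograph g = hypograph h"
  shows "g = h"
  by (rule nonneg_eqI_levels) (use assms in \<open>auto simp: hypograph_def set_eq_iff\<close>)

text \<open>The hyperplane determines its unit normal up to sign, and both signs give the same
symmetral.\<close>
lemma steiner_eq_steiner_fun:
  fixes f :: "real^'n \<Rightarrow> real"
  assumes u: "norm u = 1" and f: "closed_log_concave f"
  shows "steiner ({u}\<^sup>\<bottom>) f = steiner_fun u f"
  unfolding steiner_def
proof (rule the_equality)
  have pos: "\<And>x. 0 \<le> steiner_fun u f x" by (rule steiner_fun_levels(1) [OF u compact_level [OF f]])
  with u hypograph_steiner_fun [OF u f]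
  show "(\<forall>x. 0 \<le> steiner_fun u f x) \<and> (\<exists>v. norm v = 1 \<and> {u}\<^sup>\<bottom> = {v}\<^sup>\<bottom> \<and> hypograph (steiner_fun u f) = steiner_region v f)"
    by blast
  fix g assume g: "(\<forall>x. 0 \<le> g x) \<and> (\<exists>v. norm v = 1 \<and> {u}\<^sup>\<bottom> = {v}\<^sup>\<bottom> \<and> hypograph g = steiner_region v f)"
  then obtain v where v: "norm v = 1" "{u}\<^sup>\<bottom> = {v}\<^sup>\<bottom>" "hypograph g = steiner_region v f" by blast
  have "steiner_fun v f = steiner_fun u f"
    using unit_normal_unique [OF u v(1,2)] steiner_fun_uminus by auto
  then have "hypograph g = hypograph (steiner_fun u f)"
    using hypograph_steiner_fun [OF v(1) f] v(3) by simp
  then show "g = steiner_fun u f" using g pos by (intro hypograph_eqD) auto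
qed

lemma sym_ball_eq:
  fixes A :: "(real^'n) set"
  assumes A: "compact A"
  shows "sym_ball A = cball 0 (volume_radius A)"
proof (cases "A = {}")
  case False
  have leb: "emeasure lebesgue B = emeasure lborel B" if "compact B" for B :: "(real^'n) set"
    using that by (simp add: borel_compact)
  have "(THE r. 0 \<le> r \<and> emeasure lebesgue (cball (0 :: real^'n) r) = emeasure lebesgue A) = volume_radius A"
  proof (rule the_equality)
    show "0 \<le> volume_radius A \<and> emeasure lebesgue (cball (0 :: real^'n) (volume_radius A)) = emeasure lebesgue A"
      using False by (simp add: volume_radius_nonneg_iff leb [OF compact_cball] leb [OF A] emeasure_cball_volume_radius [OF A])
    show "r = volume_radius A"
      if "0 \<le> r \<and> emeasure lebesgue (cball (0 :: real^'n) r) = emeasure lebesgue A" for r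
      using that by (intro volume_radius_eq [OF A False]) (simp_all add: leb [OF compact_cball] leb [OF A])
  qed
  then show ?thesis using False by (simp add: sym_ball_def)
qed (simp add: sym_ball_def volume_radius_def)

lemma sym_decr_eq_symmetric_rearrangement:
  fixes f :: "real^'n \<Rightarrow> real"
  assumes f: "closed_log_concave f"
  shows "sym_decr f = symmetric_rearrangement f"
  unfolding sym_decr_def
proof (rule the_equality)
  have ball: "sym_ball {x. t \<le> f x} = {x. t \<le> symmetric_rearrangement f x}" if "0 < t" for t
    using that by (simp add: sym_ball_eq compact_level [OF f] symmetric_rearrangement_levels(2))
  have pos: "\<And>x. 0 \<le> symmetric_rearrangement f x" by (rule symmetric_rearrangement_levels(1) [OF compact_level [OF f]])
  show "(\<forall>x. 0 \<le> symmetric_rearrangement f x) \<and> (\<forall>t>0. {x. t \<le> symmetric_rearrangement f x} = sym_ball {x. t \<le> f x})"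
    using pos ball by simp
  show "g = symmetric_rearrangement f" if "(\<forall>x. 0 \<le> g x) \<and> (\<forall>t>0. {x. t \<le> g x} = sym_ball {x. t \<le> f x})" for g
    using that pos ball by (intro nonneg_eqI_levels) auto
qed

section \<open>Monotone semicontinuous functionals\<close>

text \<open>Every unit vector is a normal of some hyperplane in \<^const>\<open>Gr_hyp\<close>, so
each step of the orbit is one of the symmetrizations considered by a monotonicity
hypothesis.\<close>
lemma steiner_orbit_invariant:
  fixes f :: "real^'n \<Rightarrow> real"
  assumes "h \<in> steiner_orbit f" and f: "closed_log_concave f" and "P f"
    and step: "\<And>k H. k \<in> LC_c \<Longrightarrow> H \<in> Gr_hyp \<Longrightarrow> P k \<Longrightarrow> P (steiner H k)"
  shows "P h"
  using assms(1)
proof induction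
  case (step k u)
  have k: "closed_log_concave k" by (rule steiner_orbit_closed_log_concave [OF step(1) f])
  show ?case
    using assms(4) [of k "{u}\<^sup>\<bottom>"] k step by (simp add: LC_c_iff hyperplane_in_Gr_hyp steiner_eq_steiner_fun)
qed (rule \<open>P f\<close>)

lemma steiner_orbit_L1_tendsto_sym_decr:
  fixes f :: "real^'n \<Rightarrow> real"
  assumes f: "f \<in> LC_c"
  obtains h where "\<And>j. h j \<in> steiner_orbit f" "\<And>j. h j \<in> LC_c" "sym_decr f \<in> LC_c" "L1_tendsto h (sym_decr f)"
proof -
  have fc: "closed_log_concave f" using f by (simp add: LC_c_iff)
  obtain h where h: "\<And>j. h j \<in> steiner_orbit f"
    "(\<lambda>j. \<integral>\<^sup>+x. ennreal \<bar>h j x - symmetric_rearrangement f x\<bar> \<partial>lborel) \<longlonglongrightarrow> 0"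
    using steiner_orbit_L1_approx [OF fc] by blast
  show ?thesis
  proof (rule that [of h])
    show "h j \<in> LC_c" for j using steiner_orbit_closed_log_concave [OF h(1) fc] by (simp add: LC_c_iff)
    show "sym_decr f \<in> LC_c"
      by (simp add: LC_c_iff sym_decr_eq_symmetric_rearrangement fc closed_log_concave_symmetric_rearrangement)
    show "L1_tendsto h (sym_decr f)"
      using h(2) by (simp add: L1_tendsto_def sym_decr_eq_symmetric_rearrangement fc nn_integral_completion)
  qed (rule h(1))
qed

theorem theorem3p1:
  fixes F :: "(real^'n \<Rightarrow> real) \<Rightarrow> real"
  assumes F_pos: "\<forall>f\<in>LC_c. 0 < F f"
  shows "((\<forall>f\<in>LC_c. \<forall>H\<in>Gr_hyp. F f \<le> F (steiner H f)) \<and> L1_usc F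
            \<longrightarrow> (\<forall>f\<in>LC_c. F f \<le> F (sym_decr f)))
       \<and> ((\<forall>f\<in>LC_c. \<forall>H\<in>Gr_hyp. F (steiner H f) \<le> F f) \<and> L1_lsc F
            \<longrightarrow> (\<forall>f\<in>LC_c. F (sym_decr f) \<le> F f))"
proof (intro conjI impI ballI; elim conjE)
  fix f :: "real^'n \<Rightarrow> real"
  assume mono: "\<forall>f\<in>LC_c. \<forall>H\<in>Gr_hyp. F f \<le> F (steiner H f)" and usc: "L1_usc F" and f: "f \<in> LC_c"
  obtain h where h: "\<And>j. h j \<in> steiner_orbit f" "\<And>j. h j \<in> LC_c" "sym_decr f \<in> LC_c" "L1_tendsto h (sym_decr f)"
    using steiner_orbit_L1_tendsto_sym_decr [OF f] by blast
  have "F f \<le> F (h j)" for j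
  proof (rule steiner_orbit_invariant [OF h(1)])
    show "closed_log_concave f" using f by (simp add: LC_c_iff)
    fix k :: "real^'n \<Rightarrow> real" and H :: "(real^'n) set" assume "k \<in> LC_c" "H \<in> Gr_hyp" and k: "F f \<le> F k"
    then have "F k \<le> F (steiner H k)" using mono by blast
    with k show "F f \<le> F (steiner H k)" by simp
  qed simp
  then have "ereal (F f) \<le> limsup (\<lambda>j. ereal (F (h j)))"
    by (intro le_Limsup) auto
  also have "\<dots> \<le> ereal (F (sym_decr f))"
    using usc h unfolding L1_usc_def by blast
  finally show "F f \<le> F (sym_decr f)" by simp
next
  fix f :: "real^'n \<Rightarrow> real"
  assume mono: "\<forall>f\<in>LC_c. \<forall>H\<in>Gr_hyp. F (steiner H f) \<le> F f" and lsc: "L1_lsc F" and f: "f \<in> LC_c"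
  obtain h where h: "\<And>j. h j \<in> steiner_orbit f" "\<And>j. h j \<in> LC_c" "sym_decr f \<in> LC_c" "L1_tendsto h (sym_decr f)"
    using steiner_orbit_L1_tendsto_sym_decr [OF f] by blast
  have "F (h j) \<le> F f" for j
  proof (rule steiner_orbit_invariant [OF h(1)])
    show "closed_log_concave f" using f by (simp add: LC_c_iff)
    fix k :: "real^'n \<Rightarrow> real" and H :: "(real^'n) set" assume "k \<in> LC_c" "H \<in> Gr_hyp" and k: "F k \<le> F f"
    then have "F (steiner H k) \<le> F k" using mono by blast
    with k show "F (steiner H k) \<le> F f" by simp
  qed simp
  then have "liminf (\<lambda>j. ereal (F (h j))) \<le> ereal (F f)"
    by (intro Liminf_le) auto
  moreover have "ereal (F (sym_decr f)) \<le> liminf (\<lambda>j. ereal (F (h j)))"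
    using lsc h unfolding L1_lsc_def by blast
  ultimately have "ereal (F (sym_decr f)) \<le> ereal (F f)" by (rule order_trans [rotated])
  then show "F (sym_decr f) \<le> F f" by simp
qed

end
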